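(* Let $\beta\in(1,2]$, $b>0$, $\psi(r)=e^{br^\beta}$, and let $f:\mathbb{R}^d\to\mathbb{R}$ be an isotropic potential with $\mathcal C^2$ profile, with associated probability density $\pi\propto e^{-f}$. Suppose that $f$ satisfies the degenerate convexity assumption: there are $\mu,N_2>0$ and $\theta\ge0$ such that for all $x$ with $|x|>N_2$ and $|x|\ge b^{-1/\beta}$, $$f'(\psi(|x|))\psi'(|x|)|x|^{-1}-b\beta d|x|^{\beta-2}+(d-\beta)|x|^{-2}>\frac{\mu}{(1+\frac14|x|^2)^{\theta/2}},$$ $$f''(\psi(|x|))\psi'(|x|)^2+f'(\psi(|x|))\psi''(|x|)-b\beta(\beta-1)d|x|^{\beta-2}-(d-\beta)|x|^{-2}>\frac{\mu}{(1+\frac14|x|^2)^{\theta/2}}.$$ Let $\vartheta\in(0,2)$ and consider the non-local Dirichlet form $\mathcal E$ with parameter $\vartheta$ given in the context. Then: (1) If $\theta<2-\beta$, or $\theta=2-\beta$ and $\vartheta<\mu\beta^{-1}b^{-1}$, then $\pi$ satisfies the super Poincaré inequality, with rate function $S(r)$ as in the context for $\omega$ given (for $|x|$ large) by $$\omega(x)=\frac{C}{2^{d+\vartheta}}|x|^{(1-\theta)^{-1}(2-\theta)^{-1}\mu b^{-\frac{2-\theta}{\beta}}\log^{\frac{2-\theta}{\beta}-1}(|x|)+1-(d+\vartheta)}\log^{-\frac{d-\beta}{\beta}}(|x|)\quad\text{if }\theta<2-\beta,$$ $$\omega(x)=\frac{C}{2^{d+\vartheta}}|x|^{(2-\theta)^{-1}\mu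 b^{-\frac{2-\theta}{\beta}}\log^{\frac{2-\theta}{\beta}-1}(|x|)-\vartheta}\log^{-\frac{d-\beta}{\beta}}(|x|)\quad\text{if }\theta=2-\beta,\ \vartheta<\mu\beta^{-1}b^{-1},$$ where $C$ is some positive constant. (2) If $\theta=2-\beta$ and $\vartheta\ge\mu\beta^{-1}b^{-1}$, or $\theta>2-\beta$, then $\pi$ satisfies the weak Poincaré inequality with rate function $$W(r)=\inf_{s>0}\Big\{\frac{1}{\inf_{0<|x-y|\le s}[(e^{f(x)}+e^{f(y)})|x-y|^{-(d+\vartheta)}]}:\iint_{|x-y|>s}e^{-f(x)}e^{-f(y)}dxdy\le r/2\Big\}.$$
   Context: Isotropic: $f(x)=f(|x|)$, the same letter denoting a twice continuously differentiable profile $f:\mathbb{R}\to\mathbb{R}$; $f',f''$ are derivatives of the profile. $f$ is normalized so that $\pi=e^{-f}$. Dirichlet form: $\mathcal E(\phi)=\iint_{\{x\ne y\}}\frac{(\phi(x)-\phi(y))^2}{|x-y|^{d+\vartheta}}\,dx\,\pi(y)dy$, with domain $\mathcal D(\mathcal E)=\{\phi\in L^2(\pi):\mathcal E(\phi)<\infty\}$. Write $\pi(\varphi)=\int\varphi(x)\pi(x)dx$. Weak Poincaré inequality with rate $W$: $\mathrm{Var}_\pi(\phi)\le W(r)\mathcal E(\phi)+r\|\phi\|_\infty^2$ for all $\phi\in\mathcal D(\mathcal E)$ and $r>0$. Super Poincaré inequality with rate $S$: $\pi(\phi^2)\le r\,\mathcal E(\phi)+S(r)\pi(|\phi|)^2$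 for all $\phi\in\mathcal D(\mathcal E)$ and $r>0$, where, for a positive function $\omega$ on $\mathbb{R}^d$ (given by the stated formula for all sufficiently large $|x|$), $$S(r)=\inf_{t,s>0}\Big\{\frac{2\pi(\omega)}{\inf_{|x|\ge t}\omega(x)}+S_t(t\wedge s):\frac{2}{\inf_{|x|\ge t}\omega(x)}+s\le r\Big\},$$ $$S_t(s)=\inf_{u>0}\Big\{\frac{(\sup_{|z|\le2t}e^{f(z)})^2}{u^d\inf_{|z|\le t}e^{f(z)}}:\frac{u^\vartheta\sup_{|z|\le2t}e^{f(z)}}{\inf_{|z|\le t}e^{f(z)}}\le s\Big\}.$$ *)

theory Defs
  imports "HOL-Probability.Probability"
begin

definition C2_profile :: "(real \<Rightarrow> real) \<Rightarrow> bool" where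
  "C2_profile f \<longleftrightarrow> f differentiable_on UNIV \<and> deriv f differentiable_on UNIV
     \<and> continuous_on UNIV (deriv (deriv f))"

definition psi :: "real \<Rightarrow> real \<Rightarrow> real \<Rightarrow> real" where
  "psi b \<beta> r = exp (b * r powr \<beta>)"

definition gibbs :: "('a::euclidean_space \<Rightarrow> real) \<Rightarrow> 'a measure" where
  "gibbs F = density lborel (\<lambda>x. ennreal (exp (- F x)))"

text \<open>
  Energies and rate functions take values in \<^typ>\<open>ennreal\<close>, where the infimum of the empty set
  and the inverse of 0 are both \<open>\<infinity>\<close>, and \<open>\<infinity> * 0 = 0\<close>. The dimension is \<open>DIM('a)\<close>;
  \<open>\<alpha>\<close> is the index usually written as a variant theta, which is not an identifier letter here.
\<close>

definition dirichlet_form :: "('a::euclidean_space \<Rightarrow> real) \<Rightarrow> real \<Rightarrow> ('a \<Rightarrow> real) \<Rightarrow> ennreal" where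
  "dirichlet_form F \<alpha> \<phi> =
     (\<integral>\<^sup>+ y. (\<integral>\<^sup>+ x. ennreal ((\<phi> x - \<phi> y)\<^sup>2 / norm (x - y) powr (real DIM('a) + \<alpha>))
                  * indicator {x. x \<noteq> y} x \<partial>lborel) \<partial>gibbs F)"

definition dirichlet_domain :: "('a::euclidean_space \<Rightarrow> real) \<Rightarrow> real \<Rightarrow> ('a \<Rightarrow> real) set" where
  "dirichlet_domain F \<alpha> =
     {\<phi> \<in> borel_measurable borel. integrable (gibbs F) (\<lambda>x. (\<phi> x)\<^sup>2) \<and> dirichlet_form F \<alpha> \<phi> < \<infinity>}"

text \<open>For unbounded \<open>\<phi>\<close> the essential supremum is \<open>\<infinity>\<close>, so the inequality is then void.\<close>

definition weak_poincare ::
    "('a::euclidean_space \<Rightarrow> real) \<Rightarrow> real \<Rightarrow> (real \<Rightarrow> ennreal) \<Rightarrow> bool" where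
  "weak_poincare F \<alpha> W \<longleftrightarrow>
     (\<forall>\<phi>\<in>dirichlet_domain F \<alpha>. \<forall>r>0.
        ennreal (prob_space.variance (gibbs F) \<phi>)
          \<le> W r * dirichlet_form F \<alpha> \<phi>
             + ennreal r * (esssup (gibbs F) (\<lambda>x. ennreal \<bar>\<phi> x\<bar>))\<^sup>2)"

definition super_poincare ::
    "('a::euclidean_space \<Rightarrow> real) \<Rightarrow> real \<Rightarrow> (real \<Rightarrow> ennreal) \<Rightarrow> bool" where
  "super_poincare F \<alpha> S \<longleftrightarrow>
     (\<forall>\<phi>\<in>dirichlet_domain F \<alpha>. \<forall>r>0.
        (\<integral>\<^sup>+ x. ennreal ((\<phi> x)\<^sup>2) \<partial>gibbs F)
          \<le> ennreal r * dirichlet_form F \<alpha> \<phi> + S r * (\<integral>\<^sup>+ x. ennreal \<bar>\<phi> x\<bar> \<partial>gibbs F)\<^sup>2)"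

definition local_rate :: "('a::euclidean_space \<Rightarrow> real) \<Rightarrow> real \<Rightarrow> real \<Rightarrow> real \<Rightarrow> ennreal" where
  "local_rate F \<alpha> t s =
     (let M = (SUP z\<in>{z. norm z \<le> 2 * t}. ennreal (exp (F z)));
          m = (INF z\<in>{z. norm z \<le> t}. ennreal (exp (F z)))
      in Inf {M\<^sup>2 / (ennreal (u ^ DIM('a)) * m) | u.
                0 < u \<and> ennreal (u powr \<alpha>) * M / m \<le> ennreal s})"

definition super_rate ::
    "('a::euclidean_space \<Rightarrow> real) \<Rightarrow> real \<Rightarrow> ('a \<Rightarrow> real) \<Rightarrow> real \<Rightarrow> ennreal" where
  "super_rate F \<alpha> \<omega> r =
     (let I = (\<lambda>t. INF x\<in>{x. t \<le> norm x}. ennreal (\<omega> x))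
      in Inf {2 * (\<integral>\<^sup>+ x. ennreal (\<omega> x) \<partial>gibbs F) / I t + local_rate F \<alpha> t (min t s) | t s.
                0 < t \<and> 0 < s \<and> 2 / I t + ennreal s \<le> ennreal r})"

definition weak_rate :: "('a::euclidean_space \<Rightarrow> real) \<Rightarrow> real \<Rightarrow> real \<Rightarrow> ennreal" where
  "weak_rate F \<alpha> r =
     Inf {1 / (INF (x, y)\<in>{(x, y). 0 < norm (x - y) \<and> norm (x - y) \<le> s}.
                 ennreal ((exp (F x) + exp (F y)) * norm (x - y) powr (- (real DIM('a) + \<alpha>)))) | s.
            0 < s \<and>
            (\<integral>\<^sup>+ x. (\<integral>\<^sup>+ y. ennreal (exp (- F x) * exp (- F y)) * indicator {y. s < norm (x - y)} y
                \<partial>lborel) \<partial>lborel) \<le> ennreal (r / 2)}"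

end

theory Submission
  imports Defs
begin

text \<open>
  Symmetrizing \<open>\<E>\<close> puts the weight \<open>(e^F(x) + e^F(y)) / |x - y|^(d + \<alpha>)\<close> in front of
  \<open>(\<phi>(x) - \<phi>(y))\<^sup>2 \<pi>(x) \<pi>(y)\<close>. The weak inequality follows by splitting
  \<open>2 Var \<phi>\<close>, the integral of \<open>(\<phi>(x) - \<phi>(y))\<^sup>2\<close>, at \<open>|x - y| = s\<close>.

  For the super inequality, the degenerate convexity says that
  \<open>r \<mapsto> f(\<psi>(r)) - b d r^\<beta> + (d - \<beta>) log r\<close> has slope at least \<open>B r^(1 - \<theta>)\<close> for large \<open>r\<close>. In the
  variable \<open>L = log |x|\<close> this gives \<open>e^F(x) \<ge> c \<omega>(x) |x|^(d + \<alpha>)\<close> together with the growth of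
  \<open>f\<close> from \<open>t\<close> to \<open>2t\<close>. The tail \<open>|x| \<ge> \<kappa> t\<close> is compared with the unit ball,
  and on \<open>|x| < \<kappa> t\<close> one averages over balls of radius \<open>u\<close>. Both steps lose numerical constants.
  In the tail they are absorbed by taking \<open>C\<close> small; locally they are absorbed by the gap between
  \<open>sup e^F\<close> over the ball of radius \<open>2t\<close>, which enters the rate function, and over the
  ball of radius \<open>3\<kappa>t/2\<close>, which is what the averaging needs. For \<open>t\<close> below a threshold \<open>T\<close> the
  claim is the Poincare inequality, because \<open>\<omega>\<close> may be taken so large on \<open>|x| < T\<close> that
  \<open>2 \<pi>(\<omega>) / inf \<omega> \<ge> 1\<close>, the infimum being over \<open>|x| \<ge> t\<close>.
\<close>

subsection \<open>Symmetrization of the Dirichlet form\<close>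

lemma dirichlet_form_eq:
  fixes F \<phi> :: "'a::euclidean_space \<Rightarrow> real"
  assumes [measurable]: "F \<in> borel_measurable borel" "\<phi> \<in> borel_measurable borel"
  shows "dirichlet_form F \<alpha> \<phi> = (\<integral>\<^sup>+ y. \<integral>\<^sup>+ x.
    ennreal ((\<phi> x - \<phi> y)\<^sup>2 / norm (x - y) powr (real DIM('a) + \<alpha>) * exp (- F y)) \<partial>lborel \<partial>lborel)"
proof -
  \<comment> \<open>On the diagonal the quotient is \<open>0 / 0 = 0\<close>, so the indicator
    changes nothing.\<close>
  have "ennreal ((\<phi> x - \<phi> y)\<^sup>2 / norm (x - y) powr (real DIM('a) + \<alpha>)) * indicator {x. x \<noteq> y} x
     = ennreal ((\<phi> x - \<phi> y)\<^sup>2 / norm (x - y) powr (real DIM('a) + \<alpha>))" for x y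
    by (auto simp: indicator_def)
  moreover have "ennreal (k * exp (- F y)) = ennreal (exp (- F y)) * ennreal k" for k y
    by (simp add: ennreal_mult'' mult.commute)
  ultimately show ?thesis
    unfolding dirichlet_form_def gibbs_def
    by (subst nn_integral_density) (simp_all del: times_divide_eq_left add: nn_integral_cmult)
qed

lemma nn_integral_gibbs:
  fixes F :: "'a::euclidean_space \<Rightarrow> real"
  assumes [measurable]: "F \<in> borel_measurable borel" "g \<in> borel_measurable borel"
  shows "(\<integral>\<^sup>+ x. g x \<partial>gibbs F) = (\<integral>\<^sup>+ x. ennreal (exp (- F x)) * g x \<partial>lborel)"
  unfolding gibbs_def by (subst nn_integral_density) auto

lemma sets_gibbs [simp, measurable_cong]: "sets (gibbs F) = sets borel"
  and space_gibbs [simp]: "space (gibbs F) = UNIV"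
  by (simp_all add: gibbs_def)

text \<open>The kernel is symmetric, so exchanging the order of integration moves the density from
  \<open>y\<close> to \<open>x\<close> without changing the value; the two copies add up.\<close>

lemma dirichlet_form_symmetric:
  fixes F \<phi> :: "'a::euclidean_space \<Rightarrow> real"
  assumes [measurable]: "F \<in> borel_measurable borel" "\<phi> \<in> borel_measurable borel"
  shows "2 * dirichlet_form F \<alpha> \<phi> = (\<integral>\<^sup>+ y. \<integral>\<^sup>+ x.
    ennreal ((\<phi> x - \<phi> y)\<^sup>2 / norm (x - y) powr (real DIM('a) + \<alpha>) * (exp (- F x) + exp (- F y)))
      \<partial>lborel \<partial>lborel)"
proof -
  let ?k = "\<lambda>x y. (\<phi> x - \<phi> y)\<^sup>2 / norm (x - y) powr (real DIM('a) + \<alpha>)"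
  have sym: "?k x y = ?k y x" for x y
    by (simp add: power2_commute norm_minus_commute)
  have "(\<integral>\<^sup>+ y. \<integral>\<^sup>+ x. ennreal (?k x y * exp (- F x)) \<partial>lborel \<partial>lborel)
      = (\<integral>\<^sup>+ x. \<integral>\<^sup>+ y. ennreal (?k x y * exp (- F x)) \<partial>lborel \<partial>lborel)"
    by (rule lborel_pair.Fubini'[symmetric]) measurable
  also have "\<dots> = dirichlet_form F \<alpha> \<phi>"
    by (simp add: dirichlet_form_eq sym)
  finally have "(\<integral>\<^sup>+ y. \<integral>\<^sup>+ x. ennreal (?k x y * exp (- F x)) \<partial>lborel \<partial>lborel) = dirichlet_form F \<alpha> \<phi>" .
  moreover have "(\<integral>\<^sup>+ y. \<integral>\<^sup>+ x. ennreal (?k x y * (exp (- F x) + exp (- F y))) \<partial>lborel \<partial>lborel)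
    = (\<integral>\<^sup>+ y. \<integral>\<^sup>+ x. ennreal (?k x y * exp (- F x)) \<partial>lborel \<partial>lborel)
      + (\<integral>\<^sup>+ y. \<integral>\<^sup>+ x. ennreal (?k x y * exp (- F y)) \<partial>lborel \<partial>lborel)"
    by (subst nn_integral_add[symmetric], measurable)
       (auto simp: distrib_left ennreal_plus[symmetric] nn_integral_add[symmetric] simp del: ennreal_plus)
  ultimately show ?thesis
    by (simp add: dirichlet_form_eq mult_2)
qed

lemma nn_integral_gibbs2:
  fixes F :: "'a::euclidean_space \<Rightarrow> real"
  assumes [measurable]: "F \<in> borel_measurable borel"
    "case_prod g \<in> borel_measurable (borel \<Otimes>\<^sub>M borel)"
    and nonneg: "\<And>x y. 0 \<le> g x y"
  shows "(\<integral>\<^sup>+ y. \<integral>\<^sup>+ x. ennreal (g x y) \<partial>gibbs F \<partial>gibbs F) =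
    (\<integral>\<^sup>+ y. \<integral>\<^sup>+ x. ennreal (exp (- F x) * exp (- F y) * g x y) \<partial>lborel \<partial>lborel)"
  by (simp add: nn_integral_gibbs nn_integral_cmult[symmetric] ennreal_mult' nonneg ac_simps)

text \<open>Two independent copies: integrating over \<open>x\<close> first leaves the variance plus
  the squared distance of \<phi>(y) from the mean, and the latter integrates to the variance once
  more.\<close>

lemma (in prob_space) nn_integral_diff_square:
  fixes \<phi> :: "'a \<Rightarrow> real"
  assumes [measurable]: "\<phi> \<in> borel_measurable M" and sq: "integrable M (\<lambda>x. (\<phi> x)\<^sup>2)"
  shows "(\<integral>\<^sup>+ y. \<integral>\<^sup>+ x. ennreal ((\<phi> x - \<phi> y)\<^sup>2) \<partial>M \<partial>M) = ennreal (2 * variance \<phi>)"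
proof -
  have int: "integrable M \<phi>"
    using square_integrable_imp_integrable[OF assms] .
  note [simp] = int sq prob_space
  let ?e = "expectation \<phi>"
  have inner: "(\<integral>\<^sup>+ x. ennreal ((\<phi> x - a)\<^sup>2) \<partial>M) = ennreal (variance \<phi> + (\<phi>' - a)\<^sup>2)"
    if "\<phi>' = ?e" for a \<phi>'
  proof -
    have "(\<integral>\<^sup>+ x. ennreal ((\<phi> x - a)\<^sup>2) \<partial>M) = ennreal (\<integral>x. (\<phi> x - a)\<^sup>2 \<partial>M)"
      by (rule nn_integral_eq_integral) (simp add: power2_diff, simp)
    also have "(\<integral>x. (\<phi> x - a)\<^sup>2 \<partial>M) = variance \<phi> + (?e - a)\<^sup>2"
      by (subst variance_eq) (simp_all add: power2_diff)
    finally show ?thesis using that by simp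
  qed
  have "(\<integral>\<^sup>+ y. \<integral>\<^sup>+ x. ennreal ((\<phi> x - \<phi> y)\<^sup>2) \<partial>M \<partial>M)
    = (\<integral>\<^sup>+ y. ennreal (variance \<phi> + (?e - \<phi> y)\<^sup>2) \<partial>M)"
    by (simp add: inner)
  also have "\<dots> = ennreal (\<integral>y. variance \<phi> + (?e - \<phi> y)\<^sup>2 \<partial>M)"
    by (rule nn_integral_eq_integral) (simp add: power2_diff, simp)
  also have "(\<integral>y. variance \<phi> + (?e - \<phi> y)\<^sup>2 \<partial>M) = 2 * variance \<phi>"
  proof -
    have "(\<integral>y. v + (?e - \<phi> y)\<^sup>2 \<partial>M) = v + variance \<phi>" for v
      by (subst variance_eq) (simp_all add: power2_diff, simp add: power2_eq_square)
    then show ?thesis by simp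
  qed
  finally show ?thesis .
qed

subsection \<open>Weak Poincare inequality\<close>

text \<open>Fails for \<open>e = 0\<close> since \<open>\<infinity> * 0 = 0\<close>; functions of zero energy, or zero mean of
  \<open>|\<phi>|\<close>, are therefore treated separately.\<close>

lemma ennreal_le_Inf_mult_add:
  fixes a b e :: ennreal
  assumes le: "\<And>c. c \<in> X \<Longrightarrow> a \<le> c * e + b" and e: "e \<noteq> 0" "e \<noteq> \<infinity>"
  shows "a \<le> Inf X * e + b"
proof (cases "b = \<infinity>")
  case False
  have "(a - b) / e \<le> c" if "c \<in> X" for c
  proof -
    have "a - b \<le> c * e"
      using le[OF that] False by (simp add: ennreal_minus_le_iff add.commute)
    then show ?thesis
      using e by (intro divide_le_posI_ennreal) (auto simp: zero_less_iff_neq_zero mult.commute)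
  qed
  then have "(a - b) / e \<le> Inf X"
    by (rule Inf_greatest)
  then have "(a - b) / e * e \<le> Inf X * e"
    by (rule mult_right_mono) simp
  then have "a - b \<le> Inf X * e"
    using e by (simp add: ennreal_divide_times less_top)
  then show ?thesis
    using False by (simp add: ennreal_minus_le_iff add.commute)
qed simp

lemma ennreal_posE:
  assumes "x \<noteq> 0" "x \<noteq> \<infinity>"
  obtains r where "x = ennreal r" "0 < r"
  using assms by (cases x) auto

text \<open>The kernel and the density are positive off the diagonal, so zero energy forces
  \<phi>(x) = \<phi>(y) for almost every pair. This settles the weak inequality where an infinite
  rate meets zero energy.\<close>

lemma variance_eq_0_if_dirichlet_form_eq_0:
  fixes F \<phi> :: "'a::euclidean_space \<Rightarrow> real"
  assumes [measurable]: "F \<in> borel_measurable borel" "\<phi> \<in> borel_measurable borel"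
    and prob: "prob_space (gibbs F)" and sq: "integrable (gibbs F) (\<lambda>x. (\<phi> x)\<^sup>2)"
    and 0: "dirichlet_form F \<alpha> \<phi> = 0"
  shows "prob_space.variance (gibbs F) \<phi> = 0"
proof -
  interpret prob_space "gibbs F" by fact
  have "AE y in lborel. AE x in lborel. \<phi> x = \<phi> y \<or> x = y"
    using 0 by (simp add: dirichlet_form_eq nn_integral_0_iff_AE)
  then have ae: "AE y in lborel. AE x in lborel. \<phi> x = \<phi> y"
    by (auto elim!: eventually_mono)
  have "(\<integral>\<^sup>+ y. \<integral>\<^sup>+ x. ennreal ((\<phi> x - \<phi> y)\<^sup>2) \<partial>gibbs F \<partial>gibbs F) = 
    (\<integral>\<^sup>+ y. \<integral>\<^sup>+ x. ennreal (exp (- F x) * exp (- F y) * (\<phi> x - \<phi> y)\<^sup>2) \<partial>lborel \<partial>lborel)"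
    by (rule nn_integral_gibbs2) auto
  also have "\<dots> = (\<integral>\<^sup>+ y. 0 \<partial>(lborel::'a measure))"
    using ae by (intro nn_integral_cong_AE) (auto elim!: eventually_mono simp: nn_integral_0_iff_AE)
  finally have "ennreal (2 * variance \<phi>) = 0"
    by (subst (asm) nn_integral_diff_square) (use sq in auto)
  then show ?thesis
    using variance_positive[of \<phi>] by (simp add: ennreal_eq_0_iff)
qed

text \<open>Multiplying the lower bound \<open>c\<close> on the symmetrized weight by both densities
  turns it into a bound of the product density by the symmetrized kernel. The 2 in
  \<open>2 / c\<close> is the one from symmetrization. The region \<open>P\<close> is
  \<open>norm (x - y) \<le> s\<close> for the weak inequality and the whole space for the Poincare
  inequality.\<close>

lemma near_diagonal_le_dirichlet_form:
  fixes F \<phi> :: "'a::euclidean_space \<Rightarrow> real"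
  assumes [measurable]: "F \<in> borel_measurable borel" "\<phi> \<in> borel_measurable borel"
    and [measurable]: "Measurable.pred (borel \<Otimes>\<^sub>M borel) (case_prod P)"
    and c: "0 < c"
    and le: "\<And>x y. P x y \<Longrightarrow> x \<noteq> y \<Longrightarrow>
      c \<le> (exp (F x) + exp (F y)) * norm (x - y) powr (- (real DIM('a) + \<alpha>))"
  shows "(\<integral>\<^sup>+ y. \<integral>\<^sup>+ x. ennreal ((\<phi> x - \<phi> y)\<^sup>2 * of_bool (P x y)) \<partial>gibbs F \<partial>gibbs F)
    \<le> ennreal (2 / c) * dirichlet_form F \<alpha> \<phi>"
proof -
  let ?p = "real DIM('a) + \<alpha>"
  have pw: "exp (- F x) * exp (- F y) * ((\<phi> x - \<phi> y)\<^sup>2 * of_bool (P x y))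
    \<le> 1 / c * ((\<phi> x - \<phi> y)\<^sup>2 / norm (x - y) powr ?p * (exp (- F x) + exp (- F y)))" for x y
  proof (cases "P x y \<and> x \<noteq> y")
    case True
    have "c * (exp (- F x) * exp (- F y))
      \<le> (exp (F x) + exp (F y)) * norm (x - y) powr (- ?p) * (exp (- F x) * exp (- F y))"
      using le True by (intro mult_right_mono) auto
    also have "\<dots> = (exp (- F x) + exp (- F y)) / norm (x - y) powr ?p"
      by (simp only: powr_minus exp_minus) (simp add: field_simps)
    finally have "(\<phi> x - \<phi> y)\<^sup>2 * (c * (exp (- F x) * exp (- F y)))
      \<le> (\<phi> x - \<phi> y)\<^sup>2 * ((exp (- F x) + exp (- F y)) / norm (x - y) powr ?p)"
      by (rule mult_left_mono) auto
    then show ?thesis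
      using True c by (simp add: field_simps)
  qed (use c in auto)
  have "(\<integral>\<^sup>+ y. \<integral>\<^sup>+ x. ennreal ((\<phi> x - \<phi> y)\<^sup>2 * of_bool (P x y)) \<partial>gibbs F \<partial>gibbs F)
    = (\<integral>\<^sup>+ y. \<integral>\<^sup>+ x. ennreal (exp (- F x) * exp (- F y) * ((\<phi> x - \<phi> y)\<^sup>2 * of_bool (P x y)))
       \<partial>lborel \<partial>lborel)"
    by (rule nn_integral_gibbs2) auto
  also have "\<dots> \<le> (\<integral>\<^sup>+ y. \<integral>\<^sup>+ x. ennreal (1 / c) *
      ennreal ((\<phi> x - \<phi> y)\<^sup>2 / norm (x - y) powr ?p * (exp (- F x) + exp (- F y))) \<partial>lborel \<partial>lborel)"
    using pw c by (intro nn_integral_mono) (simp add: ennreal_mult'[symmetric])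
  also have "\<dots> = ennreal (1 / c) * (2 * dirichlet_form F \<alpha> \<phi>)"
    by (subst dirichlet_form_symmetric) (simp_all add: nn_integral_cmult)
  also have "\<dots> = ennreal (2 / c) * dirichlet_form F \<alpha> \<phi>"
  proof -
    have "ennreal (2 / c) = ennreal (1 / c) * 2"
      using c ennreal_mult'[of "1 / c" 2] by simp
    then show ?thesis by (simp add: mult.assoc)
  qed
  finally show ?thesis .
qed

lemma weak_poincare_weak_rate:
  fixes F :: "'a::euclidean_space \<Rightarrow> real"
  assumes [measurable]: "F \<in> borel_measurable borel" and prob: "prob_space (gibbs F)"
  shows "weak_poincare F \<alpha> (weak_rate F \<alpha>)"
  unfolding weak_poincare_def
proof (intro ballI allI impI)
  fix \<phi> and r :: real
  assume \<phi>: "\<phi> \<in> dirichlet_domain F \<alpha>" and r: "0 < r"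
  interpret prob_space "gibbs F" by fact
  have [measurable]: "\<phi> \<in> borel_measurable borel" and sq: "integrable (gibbs F) (\<lambda>x. (\<phi> x)\<^sup>2)"
    and fin: "dirichlet_form F \<alpha> \<phi> < \<infinity>"
    using \<phi> by (auto simp: dirichlet_domain_def)
  let ?p = "real DIM('a) + \<alpha>"
  let ?N = "esssup (gibbs F) (\<lambda>x. ennreal \<bar>\<phi> x\<bar>)"
  let ?i = "\<lambda>s. INF (x, y)\<in>{(x::'a, y). 0 < norm (x - y) \<and> norm (x - y) \<le> s}.
                 ennreal ((exp (F x) + exp (F y)) * norm (x - y) powr (- ?p))"
  show "ennreal (variance \<phi>) \<le> weak_rate F \<alpha> r * dirichlet_form F \<alpha> \<phi> + ennreal r * ?N\<^sup>2"
  \<comment> \<open>An infinite essential supremum makes the right side infinite, as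
    \<open>r > 0\<close>. In the other case the energy is a positive real, which passing to the
    infimum requires.\<close>
  proof (cases "dirichlet_form F \<alpha> \<phi> = 0 \<or> ?N = \<infinity>")
    case True
    then show ?thesis
      using variance_eq_0_if_dirichlet_form_eq_0[of F \<phi> \<alpha>] prob sq r by (auto simp: ennreal_mult_top)
  next
    case False
    then obtain n where n: "?N = ennreal n" "0 \<le> n" by (cases ?N) auto
    obtain e where e: "dirichlet_form F \<alpha> \<phi> = ennreal e" "0 < e"
      using fin False by (cases "dirichlet_form F \<alpha> \<phi>") auto
    have "AE x in gibbs F. ennreal \<bar>\<phi> x\<bar> \<le> ?N" by (rule esssup_AE)
    then have ae: "AE x in gibbs F. \<bar>\<phi> x\<bar> \<le> n"
      by eventually_elim (use n in simp)
    show ?thesis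
      unfolding weak_rate_def
    proof (rule ennreal_le_Inf_mult_add)
      fix c assume "c \<in> {1 / ?i s | s. 0 < s \<and>
            (\<integral>\<^sup>+ x. (\<integral>\<^sup>+ y. ennreal (exp (- F x) * exp (- F y)) * indicator {y. s < norm (x - y)} y
                \<partial>lborel) \<partial>lborel) \<le> ennreal (r / 2)}"
      then obtain s where c: "c = 1 / ?i s" and s: "0 < s" and
        far: "(\<integral>\<^sup>+ x. (\<integral>\<^sup>+ y. ennreal (exp (- F x) * exp (- F y)) * indicator {y. s < norm (x - y)} y
                \<partial>lborel) \<partial>lborel) \<le> ennreal (r / 2)" by auto
      show "ennreal (variance \<phi>) \<le> c * dirichlet_form F \<alpha> \<phi> + ennreal r * ?N\<^sup>2"
      proof (cases "?i s = 0")
        case True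
        then show ?thesis using c False by (simp add: ennreal_top_mult)
      next
        case nz: False
        \<comment> \<open>The pair \<open>(v, 0)\<close> lies at distance exactly \<open>s\<close>,
          hence is admissible and shows that the infimum is finite.\<close>
        obtain v :: 'a where v: "norm v = s" using vector_choose_size[of s] s by auto
        have "?i s \<le> ennreal ((exp (F v) + exp (F 0)) * norm (v - 0) powr (- ?p))"
          by (rule INF_lower2[of "(v, 0)"]) (use v s in auto)
        then have "?i s \<noteq> \<infinity>"
          unfolding infinity_ennreal_def by (rule neq_top_trans[OF ennreal_neq_top])
        with nz obtain i where i: "?i s = ennreal i" "0 < i"
          by (rule ennreal_posE)
        have near: "(\<integral>\<^sup>+ y. \<integral>\<^sup>+ x. ennreal ((\<phi> x - \<phi> y)\<^sup>2 * of_bool (norm (x - y) \<le> s)) \<partial>gibbs F \<partial>gibbs F)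
          \<le> ennreal (2 / i) * dirichlet_form F \<alpha> \<phi>"
        proof (rule near_diagonal_le_dirichlet_form)
          fix x y :: 'a assume "norm (x - y) \<le> s" "x \<noteq> y"
          then have "?i s \<le> ennreal ((exp (F x) + exp (F y)) * norm (x - y) powr (- ?p))"
            by (intro INF_lower2[of "(x, y)"]) auto
          then show "i \<le> (exp (F x) + exp (F y)) * norm (x - y) powr (- ?p)"
            unfolding i(1) by (subst (asm) ennreal_le_iff) auto
        qed (use i in auto)
        have "(\<integral>\<^sup>+ y. \<integral>\<^sup>+ x. ennreal (of_bool (s < norm (x - y))) \<partial>gibbs F \<partial>gibbs F)
          = (\<integral>\<^sup>+ y. \<integral>\<^sup>+ x. ennreal (exp (- F x) * exp (- F y) * of_bool (s < norm (x - y))) \<partial>lborel \<partial>lborel)"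
          by (rule nn_integral_gibbs2) auto
        also have "\<dots> = (\<integral>\<^sup>+ x. (\<integral>\<^sup>+ y. ennreal (exp (- F x) * exp (- F y)) * indicator {y. s < norm (x - y)} y
                \<partial>lborel) \<partial>lborel)"
          by (intro nn_integral_cong) (auto simp: indicator_def norm_minus_commute mult.commute)
        finally have far': "(\<integral>\<^sup>+ y. \<integral>\<^sup>+ x. ennreal (of_bool (s < norm (x - y))) \<partial>gibbs F \<partial>gibbs F) \<le> ennreal (r / 2)"
          using far by simp
        \<comment> \<open>Away from the diagonal only the bound \<open>n\<close> on |\<phi>| is
          available, whence (2n)^2 times the indicator of the far pairs.\<close>
        have pw: "(\<phi> x - \<phi> y)\<^sup>2 \<le> (\<phi> x - \<phi> y)\<^sup>2 * of_bool (norm (x - y) \<le> s) + 4 * n\<^sup>2 * of_bool (s < norm (x - y))"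
          if "\<bar>\<phi> x\<bar> \<le> n" "\<bar>\<phi> y\<bar> \<le> n" for x y
        proof -
          have "(\<phi> x - \<phi> y)\<^sup>2 \<le> (2 * n)\<^sup>2"
            by (rule power2_le_iff_abs_le[THEN iffD2]) (use that in auto)
          then show ?thesis by (auto simp: power2_eq_square)
        qed
        have "ennreal (2 * variance \<phi>) = (\<integral>\<^sup>+ y. \<integral>\<^sup>+ x. ennreal ((\<phi> x - \<phi> y)\<^sup>2) \<partial>gibbs F \<partial>gibbs F)"
          by (rule nn_integral_diff_square[symmetric]) (use sq in auto)
        also have "\<dots> \<le> (\<integral>\<^sup>+ y. \<integral>\<^sup>+ x. (ennreal ((\<phi> x - \<phi> y)\<^sup>2 * of_bool (norm (x - y) \<le> s))
            + ennreal (4 * n\<^sup>2) * ennreal (of_bool (s < norm (x - y)))) \<partial>gibbs F \<partial>gibbs F)"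
          apply (intro nn_integral_mono_AE)
          using ae
        proof eventually_elim
          fix y assume y: "\<bar>\<phi> y\<bar> \<le> n"
          show "(\<integral>\<^sup>+ x. ennreal ((\<phi> x - \<phi> y)\<^sup>2) \<partial>gibbs F) \<le> (\<integral>\<^sup>+ x. (ennreal ((\<phi> x - \<phi> y)\<^sup>2 * of_bool (norm (x - y) \<le> s))
            + ennreal (4 * n\<^sup>2) * ennreal (of_bool (s < norm (x - y)))) \<partial>gibbs F)"
            apply (intro nn_integral_mono_AE)
            using ae
          proof eventually_elim
            fix x assume "\<bar>\<phi> x\<bar> \<le> n"
            from pw[OF this y] show "ennreal ((\<phi> x - \<phi> y)\<^sup>2) \<le> ennreal ((\<phi> x - \<phi> y)\<^sup>2 * of_bool (norm (x - y) \<le> s))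
            + ennreal (4 * n\<^sup>2) * ennreal (of_bool (s < norm (x - y)))"
              by (simp add: ennreal_mult'[symmetric] ennreal_plus[symmetric] del: ennreal_plus)
          qed
        qed
        also have "\<dots> = (\<integral>\<^sup>+ y. \<integral>\<^sup>+ x. ennreal ((\<phi> x - \<phi> y)\<^sup>2 * of_bool (norm (x - y) \<le> s)) \<partial>gibbs F \<partial>gibbs F)
           + ennreal (4 * n\<^sup>2) * (\<integral>\<^sup>+ y. \<integral>\<^sup>+ x. ennreal (of_bool (s < norm (x - y))) \<partial>gibbs F \<partial>gibbs F)"
          by (simp add: nn_integral_add nn_integral_cmult)
        \<comment> \<open>Near pairs give \<open>2 e / i\<close> and far pairs
          \<open>4 n^2 r / 2\<close>. Both are twice what is wanted, and so is the left side: this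
          is why the far mass is required to be at most \<open>r / 2\<close>.\<close>
        also have "\<dots> \<le> ennreal (2 / i) * dirichlet_form F \<alpha> \<phi> + ennreal (4 * n\<^sup>2) * ennreal (r / 2)"
          by (intro add_mono near mult_left_mono far') simp_all
        also have "\<dots> = ennreal (2 * (e / i + r * n\<^sup>2))"
          using i r e by (simp add: ennreal_mult'[symmetric] ennreal_plus[symmetric] algebra_simps del: ennreal_plus)
        finally have "2 * variance \<phi> \<le> 2 * (e / i + r * n\<^sup>2)"
          using i e r by (subst (asm) ennreal_le_iff) auto
        then have "ennreal (variance \<phi>) \<le> ennreal (e / i + r * n\<^sup>2)"
          by (intro ennreal_leI) simp
        also have "\<dots> = c * dirichlet_form F \<alpha> \<phi> + ennreal r * ?N\<^sup>2"
        proof -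
          have "c = ennreal (1 / i)"
            unfolding c i(1) using i divide_ennreal[of 1 i] by simp
          then show ?thesis
            using i r e by (simp add: n ennreal_mult'[symmetric] ennreal_plus[symmetric] ennreal_power del: ennreal_plus)
        qed
        finally show ?thesis .
      qed
    qed (use e in auto)
  qed
qed

subsection \<open>Tail and local estimates\<close>

text \<open>Expanding, the square of \<open>b\<close> is dropped. Unlike the bound by twice the two
  squares, this keeps the coefficient 1 at the difference, and the cross term integrates to a
  product of first moments instead of a second moment.\<close>

lemma square_le_diff_square: "(a::real)\<^sup>2 \<le> (a - b)\<^sup>2 + 2 * (\<bar>a\<bar> * \<bar>b\<bar>)"
proof -
  have "a * b \<le> \<bar>a\<bar> * \<bar>b\<bar>" by (metis abs_ge_self abs_mult)
  then show ?thesis by (simp add: power2_diff)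
qed

text \<open>Every tail point \<open>x\<close> is compared with all \<open>y\<close> in the unit
  ball. Since |x - y| \<le> |x| + 1 \<le> 2|x|, the bound \<open>le\<close> trades the density at
  \<open>x\<close> for \<open>K\<close> times the jump kernel, and the cross term contributes the
  squared first moment.\<close>

lemma far_square_integral_le:
  fixes F \<phi> :: "'a::euclidean_space \<Rightarrow> real"
  assumes [measurable]: "F \<in> borel_measurable borel" "\<phi> \<in> borel_measurable borel"
    and prob: "prob_space (gibbs F)" and \<alpha>: "0 < \<alpha>" and \<rho>: "1 \<le> \<rho>" and K: "0 \<le> K"
    and le: "\<And>x. \<rho> \<le> norm x \<Longrightarrow> (2 * norm x) powr (real DIM('a) + \<alpha>) * exp (- F x) \<le> K"
  shows "emeasure (gibbs F) (ball 0 1) * (\<integral>\<^sup>+ x. ennreal ((\<phi> x)\<^sup>2 * of_bool (\<rho> \<le> norm x)) \<partial>gibbs F)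
    \<le> ennreal K * dirichlet_form F \<alpha> \<phi> + 2 * (\<integral>\<^sup>+ x. ennreal \<bar>\<phi> x\<bar> \<partial>gibbs F)\<^sup>2"
proof -
  interpret prob_space "gibbs F" by fact
  let ?P = "real DIM('a) + \<alpha>"
  let ?T = "\<lambda>x y::'a. \<rho> \<le> norm x \<and> norm y < 1"
  have pw: "exp (- F x) * exp (- F y) * ((\<phi> x - \<phi> y)\<^sup>2 * of_bool (?T x y))
    \<le> K * ((\<phi> x - \<phi> y)\<^sup>2 / norm (x - y) powr ?P * exp (- F y))" for x y
  proof (cases "?T x y \<and> x \<noteq> y")
    case True
    have "norm (x - y) \<le> 2 * norm x"
      using True \<rho> norm_triangle_ineq4[of x y] by simp
    then have "norm (x - y) powr ?P \<le> (2 * norm x) powr ?P"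
      using \<alpha> by (intro powr_mono2) auto
    then have "norm (x - y) powr ?P * exp (- F x) \<le> (2 * norm x) powr ?P * exp (- F x)"
      by (rule mult_right_mono) simp
    also have "\<dots> \<le> K" using le True by auto
    finally have "((\<phi> x - \<phi> y)\<^sup>2 * exp (- F y)) * (norm (x - y) powr ?P * exp (- F x))
      \<le> ((\<phi> x - \<phi> y)\<^sup>2 * exp (- F y)) * K"
      by (rule mult_left_mono) auto
    then show ?thesis
      using True by (simp add: field_simps)
  qed (use K in auto)
  have "(\<integral>\<^sup>+ y. \<integral>\<^sup>+ x. ennreal ((\<phi> x - \<phi> y)\<^sup>2 * of_bool (?T x y)) \<partial>gibbs F \<partial>gibbs F)
    = (\<integral>\<^sup>+ y. \<integral>\<^sup>+ x. ennreal (exp (- F x) * exp (- F y) * ((\<phi> x - \<phi> y)\<^sup>2 * of_bool (?T x y))) \<partial>lborel \<partial>lborel)"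
    by (rule nn_integral_gibbs2) auto
  also have "\<dots> \<le> (\<integral>\<^sup>+ y. \<integral>\<^sup>+ x. ennreal K * ennreal ((\<phi> x - \<phi> y)\<^sup>2 / norm (x - y) powr ?P * exp (- F y)) \<partial>lborel \<partial>lborel)"
    using pw K by (intro nn_integral_mono) (simp add: ennreal_mult'[symmetric])
  also have "\<dots> = ennreal K * dirichlet_form F \<alpha> \<phi>"
    by (simp add: dirichlet_form_eq nn_integral_cmult del: times_divide_eq_left)
  finally have near: "(\<integral>\<^sup>+ y. \<integral>\<^sup>+ x. ennreal ((\<phi> x - \<phi> y)\<^sup>2 * of_bool (?T x y)) \<partial>gibbs F \<partial>gibbs F)
    \<le> ennreal K * dirichlet_form F \<alpha> \<phi>" .
  have "emeasure (gibbs F) (ball 0 1) * (\<integral>\<^sup>+ x. ennreal ((\<phi> x)\<^sup>2 * of_bool (\<rho> \<le> norm x)) \<partial>gibbs F)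
    = (\<integral>\<^sup>+ y. (\<integral>\<^sup>+ x. ennreal ((\<phi> x)\<^sup>2 * of_bool (\<rho> \<le> norm x)) \<partial>gibbs F) * indicator (ball 0 1) y \<partial>gibbs F)"
    by (subst nn_integral_cmult_indicator) (simp_all add: mult.commute)
  also have "\<dots> = (\<integral>\<^sup>+ y. \<integral>\<^sup>+ x. ennreal ((\<phi> x)\<^sup>2 * of_bool (?T x y)) \<partial>gibbs F \<partial>gibbs F)"
    by (intro nn_integral_cong) (auto simp: indicator_def)
  also have "\<dots> \<le> (\<integral>\<^sup>+ y. \<integral>\<^sup>+ x. (ennreal ((\<phi> x - \<phi> y)\<^sup>2 * of_bool (?T x y))
      + 2 * (ennreal \<bar>\<phi> y\<bar> * ennreal \<bar>\<phi> x\<bar>)) \<partial>gibbs F \<partial>gibbs F)"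
  proof (intro nn_integral_mono)
    fix x y
    have "(\<phi> x)\<^sup>2 * of_bool (?T x y) \<le> (\<phi> x - \<phi> y)\<^sup>2 * of_bool (?T x y) + 2 * (\<bar>\<phi> y\<bar> * \<bar>\<phi> x\<bar>)"
      using square_le_diff_square[of "\<phi> x" "\<phi> y"] by (auto simp: mult.commute)
    then have "ennreal ((\<phi> x)\<^sup>2 * of_bool (?T x y)) \<le> ennreal ((\<phi> x - \<phi> y)\<^sup>2 * of_bool (?T x y) + 2 * (\<bar>\<phi> y\<bar> * \<bar>\<phi> x\<bar>))"
      by (rule ennreal_leI)
    also have "\<dots> = ennreal ((\<phi> x - \<phi> y)\<^sup>2 * of_bool (?T x y)) + 2 * (ennreal \<bar>\<phi> y\<bar> * ennreal \<bar>\<phi> x\<bar>)"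
      by (simp add: ennreal_mult')
    finally show "ennreal ((\<phi> x)\<^sup>2 * of_bool (?T x y)) \<le> ennreal ((\<phi> x - \<phi> y)\<^sup>2 * of_bool (?T x y)) + 2 * (ennreal \<bar>\<phi> y\<bar> * ennreal \<bar>\<phi> x\<bar>)" .
  qed
  also have "\<dots> = (\<integral>\<^sup>+ y. \<integral>\<^sup>+ x. ennreal ((\<phi> x - \<phi> y)\<^sup>2 * of_bool (?T x y)) \<partial>gibbs F \<partial>gibbs F)
      + 2 * (\<integral>\<^sup>+ x. ennreal \<bar>\<phi> x\<bar> \<partial>gibbs F)\<^sup>2"
    by (simp add: nn_integral_add nn_integral_cmult nn_integral_multc power2_eq_square[of "nn_integral _ _"])
  also have "\<dots> \<le> ennreal K * dirichlet_form F \<alpha> \<phi> + 2 * (\<integral>\<^sup>+ x. ennreal \<bar>\<phi> x\<bar> \<partial>gibbs F)\<^sup>2"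
    by (intro add_right_mono near)
  finally show ?thesis .
qed

text \<open>Here \<open>x\<close> is compared with the points \<open>y\<close> at distance less than
  \<open>u\<close>, whose volume is the factor on the left. There the kernel is at least
  \<open>u powr -(d + \<alpha>)\<close>, and \<open>1 \<le> M * exp (- F)\<close> inserts missing
  densities: one for the difference term, two for the cross term, which explains the square of
  \<open>M\<close>. Since \<open>y\<close> may leave the ball of radius \<rho>, the bound
  \<open>M\<close> is needed up to \<open>\<rho> + u\<close>.\<close>

lemma near_square_integral_le:
  fixes F \<phi> :: "'a::euclidean_space \<Rightarrow> real"
  assumes [measurable]: "F \<in> borel_measurable borel" "\<phi> \<in> borel_measurable borel"
    and pos: "0 < \<alpha>" "0 < u" "0 \<le> m" "0 \<le> M"
    and m: "\<And>x. norm x < \<rho> \<Longrightarrow> m \<le> exp (F x)"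
    and M: "\<And>x. norm x < \<rho> + u \<Longrightarrow> exp (F x) \<le> M"
  shows "ennreal (unit_ball_vol (real DIM('a)) * u ^ DIM('a) * m)
      * (\<integral>\<^sup>+ x. ennreal ((\<phi> x)\<^sup>2 * of_bool (norm x < \<rho>)) \<partial>gibbs F)
    \<le> ennreal (u powr (real DIM('a) + \<alpha>) * M) * dirichlet_form F \<alpha> \<phi>
      + ennreal (2 * M\<^sup>2) * (\<integral>\<^sup>+ x. ennreal \<bar>\<phi> x\<bar> \<partial>gibbs F)\<^sup>2"
proof -
  let ?P = "real DIM('a) + \<alpha>"
  let ?c = "unit_ball_vol (real DIM('a)) * u ^ DIM('a)"
  let ?T = "\<lambda>x y::'a. norm x < \<rho> \<and> norm (x - y) < u"
  have c: "0 \<le> ?c" using pos by (simp add: less_imp_le)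
  have pw: "m * exp (- F x) * ((\<phi> x)\<^sup>2 * of_bool (?T x y))
    \<le> u powr ?P * M * ((\<phi> x - \<phi> y)\<^sup>2 / norm (x - y) powr ?P * exp (- F y))
      + 2 * M\<^sup>2 * ((exp (- F y) * \<bar>\<phi> y\<bar>) * (exp (- F x) * \<bar>\<phi> x\<bar>))" for x y
  proof (cases "?T x y")
    case True
    have "norm y < \<rho> + u"
      using True norm_triangle_ineq2[of y x] by (simp add: norm_minus_commute)
    then have My: "exp (F y) \<le> M" by (rule M)
    have Mx: "exp (F x) \<le> M" using M[of x] True pos by auto
    have mx: "m * exp (- F x) \<le> 1" using m[of x] True by (simp add: exp_minus field_simps)
    have My1: "1 \<le> M * exp (- F y)" and Mx1: "1 \<le> M * exp (- F x)"
      using Mx My by (simp_all add: exp_minus field_simps)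
    have D: "(\<phi> x - \<phi> y)\<^sup>2 \<le> (u powr ?P / norm (x - y) powr ?P * (M * exp (- F y))) * (\<phi> x - \<phi> y)\<^sup>2"
    proof (cases "x = y")
      case False
      then have "norm (x - y) powr ?P \<le> u powr ?P"
        using True pos by (intro powr_mono2) auto
      then have "1 \<le> u powr ?P / norm (x - y) powr ?P"
        using False by (simp add: field_simps)
      then have "1 * 1 \<le> u powr ?P / norm (x - y) powr ?P * (M * exp (- F y))"
        using My1 by (intro mult_mono) auto
      then have "1 * (\<phi> x - \<phi> y)\<^sup>2 \<le> u powr ?P / norm (x - y) powr ?P * (M * exp (- F y)) * (\<phi> x - \<phi> y)\<^sup>2"
        by (intro mult_right_mono) simp_all
      then show ?thesis by (simp only: mult_1)
    qed simp
    have M2: "\<bar>\<phi> x\<bar> * \<bar>\<phi> y\<bar> \<le> ((M * exp (- F x)) * (M * exp (- F y))) * (\<bar>\<phi> x\<bar> * \<bar>\<phi> y\<bar>)"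
    proof -
      have "1 * 1 \<le> (M * exp (- F x)) * (M * exp (- F y))"
        using Mx1 My1 pos by (intro mult_mono) simp_all
      then have "1 * (\<bar>\<phi> x\<bar> * \<bar>\<phi> y\<bar>) \<le> ((M * exp (- F x)) * (M * exp (- F y))) * (\<bar>\<phi> x\<bar> * \<bar>\<phi> y\<bar>)"
        by (intro mult_right_mono) simp_all
      then show ?thesis by (simp only: mult_1)
    qed
    have "m * exp (- F x) * (\<phi> x)\<^sup>2 \<le> 1 * (\<phi> x)\<^sup>2"
      using mx by (intro mult_right_mono) auto
    also have "\<dots> \<le> (\<phi> x - \<phi> y)\<^sup>2 + 2 * (\<bar>\<phi> x\<bar> * \<bar>\<phi> y\<bar>)"
      using square_le_diff_square by simp
    also have "\<dots> \<le> (u powr ?P / norm (x - y) powr ?P * (M * exp (- F y))) * (\<phi> x - \<phi> y)\<^sup>2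
      + 2 * (((M * exp (- F x)) * (M * exp (- F y))) * (\<bar>\<phi> x\<bar> * \<bar>\<phi> y\<bar>))"
      by (intro add_mono D mult_left_mono M2) simp
    also have "\<dots> = u powr ?P * M * ((\<phi> x - \<phi> y)\<^sup>2 / norm (x - y) powr ?P * exp (- F y))
      + 2 * M\<^sup>2 * ((exp (- F y) * \<bar>\<phi> y\<bar>) * (exp (- F x) * \<bar>\<phi> x\<bar>))"
      by (simp add: power2_eq_square[of M])
    finally show ?thesis using True by simp
  next
    case False
    have "0 \<le> u powr ?P * M * ((\<phi> x - \<phi> y)\<^sup>2 / norm (x - y) powr ?P * exp (- F y))"
      using pos by (intro mult_nonneg_nonneg divide_nonneg_nonneg) simp_all
    moreover have "0 \<le> 2 * M\<^sup>2 * ((exp (- F y) * \<bar>\<phi> y\<bar>) * (exp (- F x) * \<bar>\<phi> x\<bar>))"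
      by (intro mult_nonneg_nonneg) simp_all
    moreover have "m * exp (- F x) * ((\<phi> x)\<^sup>2 * of_bool (?T x y)) = 0"
      using False by (simp only: of_bool_eq mult_zero_right)
    ultimately show ?thesis by linarith
  qed
  have ball: "(\<integral>\<^sup>+ y. indicator {y. norm (x - y) < u} y \<partial>lborel) = ennreal ?c" for x :: 'a
  proof -
    have "{y. norm (x - y) < u} = ball x u" by (auto simp: dist_norm)
    then show ?thesis using pos emeasure_ball[of u x] by simp
  qed
  have "ennreal (?c * m) * (\<integral>\<^sup>+ x. ennreal ((\<phi> x)\<^sup>2 * of_bool (norm x < \<rho>)) \<partial>gibbs F)
    = (\<integral>\<^sup>+ x. ennreal (m * exp (- F x) * ((\<phi> x)\<^sup>2 * of_bool (norm x < \<rho>))) * ennreal ?c \<partial>lborel)"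
    using c pos by (subst nn_integral_gibbs)
      (simp_all add: nn_integral_cmult[symmetric] ennreal_mult'[symmetric] ac_simps)
  also have "\<dots> = (\<integral>\<^sup>+ x. \<integral>\<^sup>+ y. ennreal (m * exp (- F x) * ((\<phi> x)\<^sup>2 * of_bool (?T x y))) \<partial>lborel \<partial>lborel)"
  proof (rule nn_integral_cong)
    fix x :: 'a
    show "ennreal (m * exp (- F x) * ((\<phi> x)\<^sup>2 * of_bool (norm x < \<rho>))) * ennreal ?c
      = (\<integral>\<^sup>+ y. ennreal (m * exp (- F x) * ((\<phi> x)\<^sup>2 * of_bool (?T x y))) \<partial>lborel)"
      unfolding ball[of x, symmetric]
      by (subst nn_integral_cmult[symmetric]) (auto intro!: nn_integral_cong simp: indicator_def)
  qed
  also have "\<dots> \<le> (\<integral>\<^sup>+ x. \<integral>\<^sup>+ y. (ennreal (u powr ?P * M) * ennreal ((\<phi> x - \<phi> y)\<^sup>2 / norm (x - y) powr ?P * exp (- F y))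
      + ennreal (2 * M\<^sup>2) * (ennreal (exp (- F y) * \<bar>\<phi> y\<bar>) * ennreal (exp (- F x) * \<bar>\<phi> x\<bar>))) \<partial>lborel \<partial>lborel)"
  proof (intro nn_integral_mono)
    fix x y
    have split: "ennreal (a * b + c * (d * e)) = ennreal a * ennreal b + ennreal c * (ennreal d * ennreal e)"
      if "0 \<le> a" "0 \<le> b" "0 \<le> c" "0 \<le> d" "0 \<le> e" for a b c d e :: real
      using that by (simp add: ennreal_mult ennreal_plus)
    show "ennreal (m * exp (- F x) * ((\<phi> x)\<^sup>2 * of_bool (?T x y)))
      \<le> ennreal (u powr ?P * M) * ennreal ((\<phi> x - \<phi> y)\<^sup>2 / norm (x - y) powr ?P * exp (- F y))
      + ennreal (2 * M\<^sup>2) * (ennreal (exp (- F y) * \<bar>\<phi> y\<bar>) * ennreal (exp (- F x) * \<bar>\<phi> x\<bar>))"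
      by (rule order_trans[OF ennreal_leI[OF pw[of x y]]], subst split) (use pos in simp_all)
  qed
  also have "\<dots> = ennreal (u powr ?P * M) * (\<integral>\<^sup>+ x. \<integral>\<^sup>+ y. ennreal ((\<phi> x - \<phi> y)\<^sup>2 / norm (x - y) powr ?P * exp (- F y)) \<partial>lborel \<partial>lborel)
      + ennreal (2 * M\<^sup>2) * ((\<integral>\<^sup>+ x. ennreal (exp (- F x) * \<bar>\<phi> x\<bar>) \<partial>lborel) * (\<integral>\<^sup>+ x. ennreal (exp (- F x) * \<bar>\<phi> x\<bar>) \<partial>lborel))"
    by (simp add: nn_integral_add nn_integral_cmult nn_integral_multc del: times_divide_eq_left)
  also have "(\<integral>\<^sup>+ x. \<integral>\<^sup>+ y. ennreal ((\<phi> x - \<phi> y)\<^sup>2 / norm (x - y) powr ?P * exp (- F y)) \<partial>lborel \<partial>lborel)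
      = dirichlet_form F \<alpha> \<phi>"
    by (subst dirichlet_form_eq, simp, simp) (rule lborel_pair.Fubini'[symmetric], measurable)
  also have "(\<integral>\<^sup>+ x. ennreal (exp (- F x) * \<bar>\<phi> x\<bar>) \<partial>lborel) = (\<integral>\<^sup>+ x. ennreal \<bar>\<phi> x\<bar> \<partial>gibbs F)"
    by (simp add: nn_integral_gibbs ennreal_mult')
  finally show ?thesis by (simp add: power2_eq_square)
qed

subsection \<open>Super Poincare inequality for a given weight\<close>

text \<open>Two nested infima are replaced by one inequality for each admissible triple
  \<open>t\<close>, \<open>s\<close>, \<open>u\<close>. Admissibility itself makes the extremal
  values positive reals: division by zero gives infinity, which no finite \<open>r\<close>,
  \<open>s\<close> or \<open>t\<close> dominates, and evaluation at a single point supplies the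
  remaining bounds.\<close>

lemma le_super_rate:
  fixes a e A2 :: ennreal
  assumes A2: "A2 \<noteq> 0" "A2 \<noteq> \<infinity>" and r: "0 < r"
    and \<omega>: "\<And>x. 0 < \<omega> x"
    and le: "\<And>t s u I M m. 0 < t \<Longrightarrow> 0 < s \<Longrightarrow> 0 < u \<Longrightarrow> 0 < I \<Longrightarrow> 0 < m \<Longrightarrow>
      (INF x\<in>{x::'a::euclidean_space. t \<le> norm x}. ennreal (\<omega> x)) = ennreal I \<Longrightarrow>
      (SUP z\<in>{z::'a. norm z \<le> 2 * t}. ennreal (exp (F z))) = ennreal M \<Longrightarrow>
      (INF z\<in>{z::'a. norm z \<le> t}. ennreal (exp (F z))) = ennreal m \<Longrightarrow>
      0 < M \<Longrightarrow> u powr \<alpha> * M / m \<le> t \<Longrightarrow> u powr \<alpha> * M / m \<le> s \<Longrightarrow> 2 / I + s \<le> r \<Longrightarrow>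
      a \<le> (2 * (\<integral>\<^sup>+ x. ennreal (\<omega> x) \<partial>gibbs F) / ennreal I + ennreal (M\<^sup>2 / (u ^ DIM('a) * m))) * A2
        + ennreal r * e"
  shows "a \<le> ennreal r * e + super_rate F \<alpha> \<omega> r * A2"
proof -
  have "a \<le> super_rate F \<alpha> \<omega> r * A2 + ennreal r * e"
    unfolding super_rate_def Let_def
  proof (rule ennreal_le_Inf_mult_add[OF _ A2])
    fix c
    let ?I = "\<lambda>t. INF x\<in>{x::'a. t \<le> norm x}. ennreal (\<omega> x)"
    assume "c \<in> {2 * (\<integral>\<^sup>+ x. ennreal (\<omega> x) \<partial>gibbs F) / ?I t + local_rate F \<alpha> t (min t s) | t s.
                0 < t \<and> 0 < s \<and> 2 / ?I t + ennreal s \<le> ennreal r}"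
    then obtain t s where c: "c = 2 * (\<integral>\<^sup>+ x. ennreal (\<omega> x) \<partial>gibbs F) / ?I t + local_rate F \<alpha> t (min t s)"
      and t: "0 < t" and s: "0 < s" and r': "2 / ?I t + ennreal s \<le> ennreal r"
      by auto
    obtain v :: 'a where v: "norm v = t" using vector_choose_size[of t] t by auto
    have "?I t \<le> ennreal (\<omega> v)"
      by (rule INF_lower) (use v in auto)
    then have "?I t \<noteq> \<infinity>"
      unfolding infinity_ennreal_def by (rule neq_top_trans[OF ennreal_neq_top])
    \<comment> \<open>Otherwise \<open>2 / ?I t\<close> would be infinite and could not be at most
      \<open>r\<close>.\<close>
    moreover have "?I t \<noteq> 0"
      using r' by (auto simp: ennreal_divide_zero top_unique)
    ultimately obtain I where I: "?I t = ennreal I" "0 < I"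
      by (metis ennreal_posE)
    have rI: "2 / I + s \<le> r"
    proof -
      have "2 / ennreal I = ennreal (2 / I)" using I divide_ennreal[of 2 I] by simp
      then have "ennreal (2 / I + s) \<le> ennreal r" using r' I s by simp
      then show ?thesis using r by (subst (asm) ennreal_le_iff) auto
    qed
    let ?M = "SUP z\<in>{z::'a. norm z \<le> 2 * t}. ennreal (exp (F z))"
    let ?m = "INF z\<in>{z::'a. norm z \<le> t}. ennreal (exp (F z))"
    let ?X = "2 * (\<integral>\<^sup>+ x. ennreal (\<omega> x) \<partial>gibbs F) / ennreal I"
    \<comment> \<open>For the inner infimum over \<open>u\<close> the parameters \<open>t\<close>
      and \<open>s\<close> are fixed, so the term with \<omega> is moved into the additive constant
      and the same lemma on infima applies again.\<close>
    have "a \<le> local_rate F \<alpha> t (min t s) * A2 + (?X * A2 + ennreal r * e)"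
      unfolding local_rate_def Let_def
    proof (rule ennreal_le_Inf_mult_add[OF _ A2])
      fix c' assume "c' \<in> {?M\<^sup>2 / (ennreal (u ^ DIM('a)) * ?m) | u.
                0 < u \<and> ennreal (u powr \<alpha>) * ?M / ?m \<le> ennreal (min t s)}"
      then obtain u where c': "c' = ?M\<^sup>2 / (ennreal (u ^ DIM('a)) * ?m)" and u: "0 < u"
        and le_ts: "ennreal (u powr \<alpha>) * ?M / ?m \<le> ennreal (min t s)" by auto
      have m_le: "?m \<le> ennreal (exp (F 0))"
        by (rule INF_lower) (use t in auto)
      have M_ge: "ennreal (exp (F 0)) \<le> ?M"
        by (rule SUP_upper) (use t in auto)
      have M0: "?M \<noteq> 0"
        using M_ge by (auto simp: le_zero_eq)
      have up: "ennreal (u powr \<alpha>) \<noteq> 0" using u by simp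
      have "?m \<noteq> \<infinity>"
        using m_le unfolding infinity_ennreal_def by (rule neq_top_trans[OF ennreal_neq_top])
      moreover have "?m \<noteq> 0"
      proof
        assume "?m = 0"
        with le_ts have "ennreal (u powr \<alpha>) * ?M / 0 \<le> ennreal (min t s)" by simp
        moreover have "ennreal (u powr \<alpha>) * ?M / 0 = top"
          using up M0 by (simp only: ennreal_divide_zero mult_eq_0_iff simp_thms if_False)
        ultimately show False by (simp add: top_unique)
      qed
      ultimately obtain m where m: "?m = ennreal m" "0 < m"
        by (metis ennreal_posE)
      have "?M \<noteq> \<infinity>"
      proof
        assume "?M = \<infinity>"
        with le_ts up m have "top / ennreal m \<le> ennreal (min t s)" by (simp add: ennreal_mult_top)
        then show False by (simp add: ennreal_top_divide top_unique)
      qed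
      with M0 obtain M where M: "?M = ennreal M" "0 < M"
        by (metis ennreal_posE)
      have "ennreal (u powr \<alpha> * M / m) \<le> ennreal (min t s)"
        using le_ts m M by (simp add: divide_ennreal ennreal_mult'[symmetric])
      then have ts: "u powr \<alpha> * M / m \<le> min t s"
        using t s by (subst (asm) ennreal_le_iff) auto
      have "c' = ennreal (M\<^sup>2 / (u ^ DIM('a) * m))"
        unfolding c' m(1) M(1) using m M u
        by (simp add: divide_ennreal ennreal_mult'[symmetric] ennreal_power)
      moreover have "a \<le> (?X + ennreal (M\<^sup>2 / (u ^ DIM('a) * m))) * A2 + ennreal r * e"
        by (rule le[OF t s u I(2) m(2) I(1) M(1) m(1) M(2)]) (use ts rI in auto)
      ultimately show "a \<le> c' * A2 + (?X * A2 + ennreal r * e)"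
        by (simp add: distrib_left distrib_right ac_simps)
    qed
    then show "a \<le> c * A2 + ennreal r * e"
      unfolding c I(1) by (simp add: distrib_left distrib_right ac_simps)
  qed
  then show ?thesis by (simp add: add.commute)
qed

text \<open>Taking the whole space as near region leaves no remainder, so the splitting argument
  gives a genuine Poincare inequality. It serves the small values of \<open>t\<close>.\<close>

lemma poincare_of_diagonal_bound:
  fixes F \<phi> :: "'a::euclidean_space \<Rightarrow> real"
  assumes [measurable]: "F \<in> borel_measurable borel" and prob: "prob_space (gibbs F)"
    and \<phi>: "\<phi> \<in> dirichlet_domain F \<alpha>" and c: "0 < c"
    and le: "\<And>x y. x \<noteq> y \<Longrightarrow> c \<le> (exp (F x) + exp (F y)) * norm (x - y) powr (- (real DIM('a) + \<alpha>))"
  shows "ennreal (prob_space.variance (gibbs F) \<phi>) \<le> ennreal (1 / c) * dirichlet_form F \<alpha> \<phi>"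
proof -
  interpret prob_space "gibbs F" by fact
  have [measurable]: "\<phi> \<in> borel_measurable borel" and sq: "integrable (gibbs F) (\<lambda>x. (\<phi> x)\<^sup>2)"
    and fin: "dirichlet_form F \<alpha> \<phi> < \<infinity>"
    using \<phi> by (auto simp: dirichlet_domain_def)
  obtain e where e: "dirichlet_form F \<alpha> \<phi> = ennreal e" "0 \<le> e"
    using fin by (cases "dirichlet_form F \<alpha> \<phi>") auto
  have "ennreal (2 * variance \<phi>) = (\<integral>\<^sup>+ y. \<integral>\<^sup>+ x. ennreal ((\<phi> x - \<phi> y)\<^sup>2 * of_bool True) \<partial>gibbs F \<partial>gibbs F)"
    using nn_integral_diff_square[of \<phi>] sq by simp
  also have "\<dots> \<le> ennreal (2 / c) * dirichlet_form F \<alpha> \<phi>"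
    by (rule near_diagonal_le_dirichlet_form) (use c le in auto)
  also have "\<dots> = ennreal (2 / c * e)"
    unfolding e(1) using c e(2) by (subst ennreal_mult) simp_all
  finally have "2 * variance \<phi> \<le> 2 / c * e"
    using c e(2) by (subst (asm) ennreal_le_iff) simp_all
  then have "variance \<phi> \<le> 1 / c * e" by simp
  then have "ennreal (variance \<phi>) \<le> ennreal (1 / c * e)" by (rule ennreal_leI)
  also have "\<dots> = ennreal (1 / c) * dirichlet_form F \<alpha> \<phi>"
    unfolding e(1) using c e(2) by (subst ennreal_mult) simp_all
  finally show ?thesis .
qed

text \<open>The mean is at most the first absolute moment. This converts the Poincare inequality
  into the shape of the super inequality, with coefficient 1.\<close>

lemma (in prob_space) second_moment_le_variance:
  fixes \<phi> :: "'a \<Rightarrow> real"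
  assumes [measurable]: "\<phi> \<in> borel_measurable M" and sq: "integrable M (\<lambda>x. (\<phi> x)\<^sup>2)"
  shows "(\<integral>\<^sup>+ x. ennreal ((\<phi> x)\<^sup>2) \<partial>M) \<le> ennreal (variance \<phi>) + (\<integral>\<^sup>+ x. ennreal \<bar>\<phi> x\<bar> \<partial>M)\<^sup>2"
proof -
  have int: "integrable M \<phi>"
    using square_integrable_imp_integrable[OF assms] .
  then have abs: "(\<integral>\<^sup>+ x. ennreal \<bar>\<phi> x\<bar> \<partial>M) = ennreal (expectation (\<lambda>x. \<bar>\<phi> x\<bar>))"
    by (intro nn_integral_eq_integral) auto
  have "\<bar>expectation \<phi>\<bar> \<le> expectation (\<lambda>x. \<bar>\<phi> x\<bar>)"
    by (rule integral_abs_bound)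
  then have "(expectation \<phi>)\<^sup>2 \<le> (expectation (\<lambda>x. \<bar>\<phi> x\<bar>))\<^sup>2"
    by (rule abs_le_square_iff[THEN iffD1, OF order_trans]) simp
  then have "expectation (\<lambda>x. (\<phi> x)\<^sup>2) \<le> variance \<phi> + (expectation (\<lambda>x. \<bar>\<phi> x\<bar>))\<^sup>2"
    using variance_eq[OF int sq] by simp
  moreover have "(\<integral>\<^sup>+ x. ennreal ((\<phi> x)\<^sup>2) \<partial>M) = ennreal (expectation (\<lambda>x. (\<phi> x)\<^sup>2))"
    by (rule nn_integral_eq_integral) (use sq in auto)
  ultimately have "(\<integral>\<^sup>+ x. ennreal ((\<phi> x)\<^sup>2) \<partial>M) \<le> ennreal (variance \<phi> + (expectation (\<lambda>x. \<bar>\<phi> x\<bar>))\<^sup>2)"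
    by (simp only: ennreal_leI)
  also have "\<dots> = ennreal (variance \<phi>) + (\<integral>\<^sup>+ x. ennreal \<bar>\<phi> x\<bar> \<partial>M)\<^sup>2"
    unfolding abs by (simp add: ennreal_plus variance_positive ennreal_power integral_nonneg)
  finally show ?thesis .
qed

lemma ennreal_mult_add_mult_power2:
  assumes "0 \<le> a" "0 \<le> b" "0 \<le> c" "0 \<le> d"
  shows "ennreal a * ennreal b + ennreal c * (ennreal d)\<^sup>2 = ennreal (a * b + c * d\<^sup>2)"
  using assms by (simp add: ennreal_mult ennreal_plus ennreal_power)

text \<open>For \<open>t < T\<close>, \<open>small\<close> makes the Poincare inequality sufficient.
  For larger \<open>t\<close> the space is split at radius \<open>\<kappa> * t\<close>. Outside,
  \<open>tail\<close> feeds the comparison with the unit ball; its point \<open>z\<close> has norm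
  at least \<open>t\<close>, so \<omega>(z) bounds the infimum \<open>I\<close> from above. Inside,
  \<open>growth\<close> provides one point of the ball of radius \<open>2 * t\<close> where
  \<open>exp F\<close> is large enough to pay for all constants.\<close>

lemma super_poincare_super_rate:
  fixes F \<omega> :: "'a::euclidean_space \<Rightarrow> real"
  assumes [measurable]: "F \<in> borel_measurable borel" and prob: "prob_space (gibbs F)"
    and \<alpha>: "0 < \<alpha>" and \<omega>: "\<And>x. 0 < \<omega> x"
    and p: "emeasure (gibbs F) (ball 0 1) = ennreal p" "0 < p"
    and c: "0 < c" "\<And>x y. x \<noteq> y \<Longrightarrow> c \<le> (exp (F x) + exp (F y)) * norm (x - y) powr (- (real DIM('a) + \<alpha>))"
    and \<kappa>: "0 < \<kappa>" "\<kappa> \<le> 1" "1 \<le> \<kappa> * T"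
    and small: "\<And>t. 0 < t \<Longrightarrow> t < T \<Longrightarrow>
      \<exists>x. t \<le> norm x \<and> \<omega> x \<le> 2 * c \<and> ennreal (\<omega> x) \<le> 2 * (\<integral>\<^sup>+ x. ennreal (\<omega> x) \<partial>gibbs F)"
    and tail: "\<And>t x. T \<le> t \<Longrightarrow> \<kappa> * t \<le> norm x \<Longrightarrow>
      \<exists>z. t \<le> norm z \<and> (2 * norm x) powr (real DIM('a) + \<alpha>) * exp (- F x) * \<omega> z \<le> 2 * p"
    and growth: "\<And>t. T \<le> t \<Longrightarrow> \<exists>z. norm z \<le> 2 * t
      \<and> (\<forall>x. norm x \<le> 3 / 2 * (\<kappa> * t) \<longrightarrow> (4 / unit_ball_vol (real DIM('a)) + 1) * exp (F x) \<le> exp (F z))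
      \<and> 4 / p * t ^ DIM('a) \<le> exp (F z) \<and> t * exp (F 0) \<le> (\<kappa> * t / 2) powr \<alpha> * exp (F z)"
  shows "super_poincare F \<alpha> (super_rate F \<alpha> \<omega>)"
  unfolding super_poincare_def
proof (intro ballI allI impI)
  fix \<phi> and r :: real
  assume \<phi>: "\<phi> \<in> dirichlet_domain F \<alpha>" and r: "0 < r"
  interpret prob_space "gibbs F" by fact
  have [measurable]: "\<phi> \<in> borel_measurable borel" and sq: "integrable (gibbs F) (\<lambda>x. (\<phi> x)\<^sup>2)"
    and fin: "dirichlet_form F \<alpha> \<phi> < \<infinity>"
    using \<phi> by (auto simp: dirichlet_domain_def)
  let ?A = "\<integral>\<^sup>+ x. ennreal \<bar>\<phi> x\<bar> \<partial>gibbs F"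
  let ?E = "dirichlet_form F \<alpha> \<phi>"
  show "(\<integral>\<^sup>+ x. ennreal ((\<phi> x)\<^sup>2) \<partial>gibbs F) \<le> ennreal r * ?E + super_rate F \<alpha> \<omega> r * ?A\<^sup>2"
  proof (cases "?A = 0")
    case True
    then have "AE x in gibbs F. \<phi> x = 0"
      by (subst (asm) nn_integral_0_iff_AE) auto
    then have "(\<integral>\<^sup>+ x. ennreal ((\<phi> x)\<^sup>2) \<partial>gibbs F) = (\<integral>\<^sup>+ x. 0 \<partial>gibbs F)"
      by (intro nn_integral_cong_AE) (auto elim!: eventually_mono)
    then show ?thesis by simp
  next
    case False
    have "integrable (gibbs F) \<phi>"
      by (rule square_integrable_imp_integrable) (use sq in auto)
    then have A_fin: "?A \<noteq> \<infinity>"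
      by (auto simp: integrable_iff_bounded)
    obtain A where A: "?A = ennreal A" "0 < A"
      using False A_fin by (rule ennreal_posE)
    obtain e where e: "?E = ennreal e" "0 \<le> e"
      using fin by (cases ?E) auto
    define q where "q = expectation (\<lambda>x. (\<phi> x)\<^sup>2)"
    have q: "(\<integral>\<^sup>+ x. ennreal ((\<phi> x)\<^sup>2) \<partial>gibbs F) = ennreal q"
      unfolding q_def by (rule nn_integral_eq_integral) (use sq in auto)
    have part: "\<exists>a\<ge>0. (\<integral>\<^sup>+ x. ennreal ((\<phi> x)\<^sup>2 * of_bool (P x)) \<partial>gibbs F) = ennreal a"
      if [measurable]: "Measurable.pred borel P" for P
    proof -
      have "(\<integral>\<^sup>+ x. ennreal ((\<phi> x)\<^sup>2 * of_bool (P x)) \<partial>gibbs F) \<le> ennreal q"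
        unfolding q[symmetric] by (intro nn_integral_mono ennreal_leI) auto
      then show ?thesis
        by (cases "\<integral>\<^sup>+ x. ennreal ((\<phi> x)\<^sup>2 * of_bool (P x)) \<partial>gibbs F") (auto simp: top_unique)
    qed
    show ?thesis
    proof (rule le_super_rate[OF _ _ r \<omega>])
      show "?A\<^sup>2 \<noteq> 0" "?A\<^sup>2 \<noteq> \<infinity>"
        using A by (simp_all add: ennreal_power)
      fix t s u I M m :: real
      assume t: "0 < t" and s: "0 < s" and u: "0 < u" and I: "0 < I" and m: "0 < m"
        and IE: "(INF x\<in>{x::'a. t \<le> norm x}. ennreal (\<omega> x)) = ennreal I"
        and ME: "(SUP z\<in>{z::'a. norm z \<le> 2 * t}. ennreal (exp (F z))) = ennreal M"
        and mE: "(INF z\<in>{z::'a. norm z \<le> t}. ennreal (exp (F z))) = ennreal m"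
        and M: "0 < M" and ut: "u powr \<alpha> * M / m \<le> t" and us: "u powr \<alpha> * M / m \<le> s"
        and Ir: "2 / I + s \<le> r"
      have I_le: "I \<le> \<omega> x" if "t \<le> norm x" for x
      proof -
        have "ennreal I \<le> ennreal (\<omega> x)" unfolding IE[symmetric] by (rule INF_lower) (use that in auto)
        then show ?thesis using \<omega>[of x] by (subst (asm) ennreal_le_iff) auto
      qed
      have M_ge: "exp (F x) \<le> M" if "norm x \<le> 2 * t" for x
      proof -
        have "ennreal (exp (F x)) \<le> ennreal M" unfolding ME[symmetric] by (rule SUP_upper) (use that in auto)
        then show ?thesis using M by (subst (asm) ennreal_le_iff) auto
      qed
      have m_le: "m \<le> exp (F x)" if "norm x \<le> t" for x
      proof -
        have "ennreal m \<le> ennreal (exp (F x))" unfolding mE[symmetric] by (rule INF_lower) (use that in auto)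
        then show ?thesis by (subst (asm) ennreal_le_iff) auto
      qed
      let ?X = "2 * (\<integral>\<^sup>+ x. ennreal (\<omega> x) \<partial>gibbs F) / ennreal I"
      let ?Y = "M\<^sup>2 / (u ^ DIM('a) * m)"
      show "(\<integral>\<^sup>+ x. ennreal ((\<phi> x)\<^sup>2) \<partial>gibbs F) \<le> (?X + ennreal ?Y) * ?A\<^sup>2 + ennreal r * ?E"
      proof (cases "t < T")
        case True
        obtain x where x: "t \<le> norm x" "\<omega> x \<le> 2 * c" "ennreal (\<omega> x) \<le> 2 * (\<integral>\<^sup>+ x. ennreal (\<omega> x) \<partial>gibbs F)"
          using small[OF t True] by blast
        \<comment> \<open>The infimum \<open>I\<close> is at most \<omega>(x), hence at most
          \<open>2 * c\<close>. So the constraint on \<open>r\<close> already contains the Poincare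
          constant, and \<open>?X \<ge> 1\<close> pays for the squared mean.\<close>
        have "1 / c \<le> 2 / I"
          using I_le[OF x(1)] x(2) I c(1) by (simp add: field_simps)
        then have cr: "1 / c \<le> r" using Ir s by linarith
        have "1 = ennreal I / ennreal I"
          using I by simp
        also have "\<dots> \<le> ?X"
          by (intro divide_right_mono_ennreal order_trans[OF _ x(3)] ennreal_leI I_le x(1))
        finally have X: "1 \<le> ?X" .
        have "(\<integral>\<^sup>+ x. ennreal ((\<phi> x)\<^sup>2) \<partial>gibbs F) \<le> ennreal (variance \<phi>) + ?A\<^sup>2"
          by (rule second_moment_le_variance) (use sq in auto)
        also have "\<dots> \<le> ennreal (1 / c) * ?E + 1 * ?A\<^sup>2"
          using poincare_of_diagonal_bound[OF _ prob \<phi> c] by (intro add_mono) auto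
        also have "\<dots> \<le> ennreal r * ?E + (?X + ennreal ?Y) * ?A\<^sup>2"
          using X cr by (intro add_mono mult_right_mono ennreal_leI add_increasing2) auto
        finally show ?thesis by (simp add: add.commute)
      next
        case False
        then have tT: "T \<le> t" by simp
        obtain z where z: "norm z \<le> 2 * t"
          "\<And>x. norm x \<le> 3 / 2 * (\<kappa> * t) \<Longrightarrow> (4 / unit_ball_vol (real DIM('a)) + 1) * exp (F x) \<le> exp (F z)"
          "4 / p * t ^ DIM('a) \<le> exp (F z)" "t * exp (F 0) \<le> (\<kappa> * t / 2) powr \<alpha> * exp (F z)"
          using growth[OF tT] by blast
        let ?v = "unit_ball_vol (real DIM('a))"
        have v: "0 < ?v" by simp
        \<comment> \<open>The factor must beat \<open>1 / ?v\<close> in the energy term, where it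
          enters linearly, and \<open>4 / ?v\<close> in the moment term, where it enters squared.
          Adding 1 makes \<open>k \<ge> 1\<close>, so one choice does both.\<close>
        define k where "k = 4 / ?v + 1"
        have k: "1 \<le> k" "1 / ?v \<le> k" "4 / ?v \<le> k\<^sup>2"
        proof -
          show k1: "1 \<le> k" using v by (simp add: k_def)
          have "1 / ?v \<le> 4 / ?v" using v by (intro divide_right_mono) auto
          then show "1 / ?v \<le> k" by (simp add: k_def)
          have "4 / ?v \<le> k * 1" using v by (simp add: k_def)
          also have "\<dots> \<le> k * k" using k1 by (intro mult_left_mono) auto
          finally show "4 / ?v \<le> k\<^sup>2" by (simp add: power2_eq_square)
        qed
        \<comment> \<open>By \<open>growth\<close>, \<open>N\<close> bounds \<open>exp F\<close> on
          the ball of radius \<open>3 / 2 * (\<kappa> * t)\<close>, while \<open>k * N\<close> is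
          still below the supremum \<open>M\<close> over the ball of radius
          \<open>2 * t\<close>.\<close>
        define N where "N = exp (F z) / k"
        have N: "0 < N" "k * N \<le> M"
          using k M_ge[OF z(1)] by (simp_all add: N_def)
        have kt: "1 \<le> \<kappa> * t" "\<kappa> * t \<le> t"
        proof -
          have "\<kappa> * T \<le> \<kappa> * t" using tT \<kappa>(1) by (intro mult_left_mono) auto
          then show "1 \<le> \<kappa> * t" using \<kappa>(3) by linarith
          show "\<kappa> * t \<le> t" using \<kappa> t by (simp add: mult_left_le_one_le)
        qed
        have mM: "m \<le> M"
          using m_le[of 0] M_ge[of 0] t by simp
        \<comment> \<open>This is where the minimum of \<open>t\<close> and \<open>s\<close> in the
          local rate matters: the constraint by \<open>t\<close> keeps the averaging radius so small
          that \<open>\<kappa> * t + u\<close> stays within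
          \<open>3 / 2 * (\<kappa> * t)\<close>.\<close>
        have u_le: "u \<le> \<kappa> * t / 2"
        proof -
          have "u powr \<alpha> * exp (F z) \<le> u powr \<alpha> * M"
            using M_ge[OF z(1)] by (intro mult_left_mono) auto
          also have "\<dots> \<le> t * m" using ut m by (simp add: field_simps)
          also have "\<dots> \<le> t * exp (F 0)" using m_le[of 0] t by (intro mult_left_mono) auto
          also have "\<dots> \<le> (\<kappa> * t / 2) powr \<alpha> * exp (F z)" by (rule z)
          finally have "u powr \<alpha> \<le> (\<kappa> * t / 2) powr \<alpha>" by simp
          then show ?thesis
            using \<alpha> u kt by (meson not_le powr_less_mono2 less_imp_le divide_nonneg_nonneg zero_le_numeral order_trans zero_le_one)
        qed
        obtain B1 where B1: "(\<integral>\<^sup>+ x. ennreal ((\<phi> x)\<^sup>2 * of_bool (\<kappa> * t \<le> norm x)) \<partial>gibbs F) = ennreal B1" "0 \<le> B1"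
          using part[of "\<lambda>x. \<kappa> * t \<le> norm x"] by auto
        obtain B2 where B2: "(\<integral>\<^sup>+ x. ennreal ((\<phi> x)\<^sup>2 * of_bool (norm x < \<kappa> * t)) \<partial>gibbs F) = ennreal B2" "0 \<le> B2"
          using part[of "\<lambda>x. norm x < \<kappa> * t"] by auto
        have "ennreal q = (\<integral>\<^sup>+ x. (ennreal ((\<phi> x)\<^sup>2 * of_bool (\<kappa> * t \<le> norm x)) + ennreal ((\<phi> x)\<^sup>2 * of_bool (norm x < \<kappa> * t))) \<partial>gibbs F)"
          unfolding q[symmetric] by (intro nn_integral_cong) auto
        also have "\<dots> = ennreal (B1 + B2)"
          using B1(2) B2(2) by (subst nn_integral_add) (simp_all add: B1(1) B2(1) ennreal_plus)
        finally have qB: "q \<le> B1 + B2"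
          using B1 B2 by (metis add_nonneg_nonneg ennreal_le_iff order_refl)
        \<comment> \<open>With \<open>K = 2 * p / I\<close>, division by the mass \<open>p\<close>
          of the unit ball yields exactly the energy coefficient \<open>2 / I\<close> allowed in the
          rate function.\<close>
        have "emeasure (gibbs F) (ball 0 1) * (\<integral>\<^sup>+ x. ennreal ((\<phi> x)\<^sup>2 * of_bool (\<kappa> * t \<le> norm x)) \<partial>gibbs F)
          \<le> ennreal (2 * p / I) * ?E + 2 * ?A\<^sup>2"
        proof (rule far_square_integral_le)
          fix x :: 'a assume "\<kappa> * t \<le> norm x"
          then obtain z' where z': "t \<le> norm z'" "(2 * norm x) powr (real DIM('a) + \<alpha>) * exp (- F x) * \<omega> z' \<le> 2 * p"
            using tail[OF tT] by blast
          have "(2 * norm x) powr (real DIM('a) + \<alpha>) * exp (- F x) * I \<le> 2 * p"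
            by (rule order_trans[OF mult_left_mono[OF I_le[OF z'(1)]] z'(2)]) simp
          then show "(2 * norm x) powr (real DIM('a) + \<alpha>) * exp (- F x) \<le> 2 * p / I"
            using I by (simp only: pos_le_divide_eq)
        qed (use \<alpha> kt p I prob in auto)
        then have "ennreal (p * B1) \<le> ennreal (2 * p / I * e + 2 * A\<^sup>2)"
          unfolding p(1) B1(1) e(1) A(1)
          using ennreal_mult_add_mult_power2[of "2 * p / I" e 2 A] p(2) B1(2) e(2) A(2) I
          by (simp only: ennreal_mult ennreal_numeral less_imp_le zero_le_numeral zero_le_mult_iff zero_le_divide_iff simp_thms)
        then have "p * B1 \<le> 2 * p / I * e + 2 * A\<^sup>2"
          using p(2) e(2) I by (subst (asm) ennreal_le_iff) auto
        then have "B1 \<le> (2 * p / I * e + 2 * A\<^sup>2) / p"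
          using p(2) by (simp add: pos_le_divide_eq mult.commute)
        then have B1_le: "B1 \<le> 2 / I * e + 2 / p * A\<^sup>2"
          using p(2) by (simp add: add_divide_distrib)
        have "ennreal (?v * u ^ DIM('a) * m) * (\<integral>\<^sup>+ x. ennreal ((\<phi> x)\<^sup>2 * of_bool (norm x < \<kappa> * t)) \<partial>gibbs F)
          \<le> ennreal (u powr (real DIM('a) + \<alpha>) * N) * ?E + ennreal (2 * N\<^sup>2) * ?A\<^sup>2"
        proof (rule near_square_integral_le)
          fix x :: 'a assume "norm x < \<kappa> * t + u"
          then have "norm x \<le> 3 / 2 * (\<kappa> * t)" using u_le by simp
          from z(2)[OF this] show "exp (F x) \<le> N"
            using k(1) unfolding N_def k_def[symmetric] by (simp add: pos_le_divide_eq mult.commute)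
        qed (use \<alpha> u m N kt m_le in auto)
        then have "ennreal (?v * u ^ DIM('a) * m * B2) \<le> ennreal (u powr (real DIM('a) + \<alpha>) * N * e + 2 * N\<^sup>2 * A\<^sup>2)"
          unfolding B2(1) e(1) A(1)
          using ennreal_mult_add_mult_power2[of "u powr (real DIM('a) + \<alpha>) * N" e "2 * N\<^sup>2" A]
            ennreal_mult''[of B2 "?v * u ^ DIM('a) * m"] B2(2) e(2) A(2) N(1)
          by simp
        then have "?v * u ^ DIM('a) * m * B2 \<le> u powr (real DIM('a) + \<alpha>) * N * e + 2 * N\<^sup>2 * A\<^sup>2"
          using N(1) e(2) by (subst (asm) ennreal_le_iff) auto
        then have "B2 \<le> (u powr (real DIM('a) + \<alpha>) * N * e + 2 * N\<^sup>2 * A\<^sup>2) / (?v * u ^ DIM('a) * m)"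
          using v u m by (simp add: pos_le_divide_eq mult.commute mult.left_commute)
        also have "\<dots> = u powr \<alpha> * (N / ?v) / m * e + 2 * N\<^sup>2 / ?v / (u ^ DIM('a) * m) * A\<^sup>2"
        proof -
          have "(u powr (real DIM('a) + \<alpha>) * N * e + 2 * N\<^sup>2 * A\<^sup>2) / (w * u ^ DIM('a) * m)
            = u powr \<alpha> * (N / w) / m * e + 2 * N\<^sup>2 / w / (u ^ DIM('a) * m) * A\<^sup>2" if "0 < w" for w
            using that u m by (simp add: powr_add powr_realpow field_simps)
          then show ?thesis using v by blast
        qed
        also have "\<dots> \<le> u powr \<alpha> * M / m * e + M\<^sup>2 / 2 / (u ^ DIM('a) * m) * A\<^sup>2"
        proof (intro add_mono mult_right_mono divide_right_mono mult_left_mono)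
          have "1 / ?v * N \<le> k * N" using k N by (intro mult_right_mono) auto
          then show "N / ?v \<le> M" using N by simp
          have "4 / ?v * N\<^sup>2 \<le> k\<^sup>2 * N\<^sup>2" using k by (intro mult_right_mono) auto
          also have "\<dots> = (k * N)\<^sup>2" by (simp add: power_mult_distrib)
          also have "\<dots> \<le> M\<^sup>2" using k N by (intro power_mono) auto
          finally show "2 * N\<^sup>2 / ?v \<le> M\<^sup>2 / 2" by simp
        qed (use e m u in auto)
        finally have B2_le: "B2 \<le> u powr \<alpha> * M / m * e + ?Y / 2 * A\<^sup>2" by simp
        \<comment> \<open>From \<open>u \<le> t\<close> and \<open>m \<le> M\<close>, the claim
          follows once \<open>M\<close> exceeds \<open>4 / p * t ^ DIM('a)\<close>. It lets half of
          \<open>?Y\<close> absorb the moment coefficient \<open>2 / p\<close> of the tail.\<close>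
        have Y: "4 / p \<le> ?Y"
        proof -
          have "4 / p * (u ^ DIM('a) * m) \<le> 4 / p * (t ^ DIM('a) * M)"
            using u u_le kt p m mM by (intro mult_left_mono mult_mono power_mono) auto
          also have "\<dots> = 4 / p * t ^ DIM('a) * M" by simp
          also have "\<dots> \<le> M * M"
            using z(3) M_ge[OF z(1)] M by (intro mult_right_mono) auto
          finally show ?thesis using u m by (simp add: pos_le_divide_eq power2_eq_square)
        qed
        \<comment> \<open>The energy coefficients add up to at most
          \<open>2 / I + s \<le> r\<close>; tail and local part each use one half of
          \<open>?Y\<close>.\<close>
        have "q \<le> 2 / I * e + 2 / p * A\<^sup>2 + (u powr \<alpha> * M / m * e + ?Y / 2 * A\<^sup>2)"
          using qB B1_le B2_le by linarith
        also have "\<dots> \<le> 2 / I * e + ?Y / 2 * A\<^sup>2 + (s * e + ?Y / 2 * A\<^sup>2)"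
          using us e(2) Y by (intro add_mono mult_right_mono) auto
        also have "\<dots> = (2 / I + s) * e + ?Y * A\<^sup>2"
          using field_sum_of_halves[of "?Y * A\<^sup>2"] by (simp only: distrib_right times_divide_eq_left)
        also have "\<dots> \<le> r * e + ?Y * A\<^sup>2"
          using Ir e(2) by (intro add_mono mult_right_mono) auto
        finally have "ennreal q \<le> ennreal (r * e + ?Y * A\<^sup>2)" by (rule ennreal_leI)
        also have "\<dots> = ennreal ?Y * ?A\<^sup>2 + ennreal r * ?E"
          unfolding e(1) A(1) using ennreal_mult_add_mult_power2[of r e ?Y A] r e(2) u m A(2)
          by (simp add: ac_simps)
        also have "\<dots> \<le> (?X + ennreal ?Y) * ?A\<^sup>2 + ennreal r * ?E"
          by (intro add_mono mult_right_mono add_increasing) auto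
        finally show ?thesis by (simp add: q)
      qed
    qed
  qed
qed

subsection \<open>Radial potentials\<close>

lemma borel_measurable_radial:
  fixes F :: "'a::real_normed_vector \<Rightarrow> real" and f :: "real \<Rightarrow> real"
  assumes "\<And>x. F x = f (norm x)" and "continuous_on UNIV f"
  shows "F \<in> borel_measurable borel"
proof -
  have "F = f \<circ> norm" using assms(1) by auto
  moreover have "continuous_on UNIV (f \<circ> norm :: 'a \<Rightarrow> real)"
    by (intro continuous_on_compose continuous_on_norm_id continuous_on_subset[OF assms(2)]) auto
  ultimately show ?thesis
    by (simp only: borel_measurable_continuous_onI)
qed

text \<open>The density is strictly positive, so a null ball would also be null for Lebesgue
  measure.\<close>

lemma measure_gibbs_ball_pos:
  fixes F :: "'a::euclidean_space \<Rightarrow> real"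
  assumes [measurable]: "F \<in> borel_measurable borel" and prob: "prob_space (gibbs F)" and \<rho>: "0 < \<rho>"
  obtains p where "emeasure (gibbs F) (ball 0 \<rho>) = ennreal p" "0 < p"
proof -
  interpret prob_space "gibbs F" by fact
  have "emeasure (gibbs F) (ball 0 \<rho>) = (\<integral>\<^sup>+ x. ennreal (exp (- F x)) * indicator (ball 0 \<rho>) x \<partial>lborel)"
    unfolding gibbs_def by (subst emeasure_density) auto
  moreover have "\<dots> \<noteq> 0"
  proof
    assume "(\<integral>\<^sup>+ x. ennreal (exp (- F x)) * indicator (ball 0 \<rho>) x \<partial>lborel) = 0"
    then have "AE x in lborel. x \<notin> ball (0::'a) \<rho>"
      by (subst (asm) nn_integral_0_iff_AE) (auto elim!: eventually_mono simp: indicator_def split: if_splits)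
    then have "emeasure lborel (ball (0::'a) \<rho>) = 0"
      by (subst (asm) AE_iff_null_sets[symmetric]) auto
    moreover have "emeasure lborel (ball (0::'a) \<rho>) > 0"
      using \<rho> by (simp add: emeasure_ball)
    ultimately show False by simp
  qed
  ultimately have "emeasure (gibbs F) (ball 0 \<rho>) \<noteq> 0" by simp
  moreover have "emeasure (gibbs F) (ball 0 \<rho>) \<noteq> \<infinity>" by simp
  ultimately show thesis
    using that by (rule ennreal_posE)
qed

text \<open>A dyadic majorant: the value on the shell between 2^k and 2^(k+1) is at most
  2^(-(d+\<alpha>)k), and the enclosing ball has volume of order 2^(dk), so a geometric series with
  ratio 2^(-\<alpha>) remains.\<close>

lemma nn_integral_norm_powr_lt_top:
  assumes "0 < \<alpha>"
  shows "(\<integral>\<^sup>+ (x::'a::euclidean_space). ennreal (norm x powr (- (real DIM('a) + \<alpha>)) * of_bool (1 \<le> norm x)) \<partial>lborel) < \<infinity>"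
proof -
  let ?P = "real DIM('a) + \<alpha>"
  let ?V = "unit_ball_vol (real DIM('a))"
  let ?q = "2 powr (- \<alpha>) :: real"
  have pw: "ennreal (norm x powr (- ?P) * of_bool (1 \<le> norm x))
    \<le> (\<Sum>k. ennreal (2 powr (- ?P * real k)) * indicator (cball 0 (2 ^ Suc k)) x)" for x :: 'a
  proof (cases "1 \<le> norm x")
    case True
    \<comment> \<open>The index of the dyadic shell containing \<open>x\<close>; this single term of
      the series already dominates the integrand.\<close>
    define k where "k = nat \<lfloor>log 2 (norm x)\<rfloor>"
    have k: "real k \<le> log 2 (norm x)" "log 2 (norm x) \<le> real (Suc k)"
    proof -
      have "0 \<le> log 2 (norm x)" using True by (subst zero_le_log_cancel_iff) auto
      then have "real k = of_int \<lfloor>log 2 (norm x)\<rfloor>" by (simp add: k_def)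
      then show "real k \<le> log 2 (norm x)" "log 2 (norm x) \<le> real (Suc k)" by linarith+
    qed
    have "2 powr real k \<le> norm x" "norm x \<le> 2 powr real (Suc k)"
      using k True le_log_iff[of 2 "norm x" "real k"] log_le_iff[of 2 "norm x" "real (Suc k)"] by force+
    then have k2: "(2 powr real k) powr (- ?P) \<ge> norm x powr (- ?P)" "x \<in> cball 0 (2 ^ Suc k)"
      using assms True by (auto intro!: powr_mono2' simp: powr_realpow simp del: of_nat_Suc)
    have "ennreal (norm x powr (- ?P) * of_bool (1 \<le> norm x)) \<le> ennreal (2 powr (- ?P * real k)) * indicator (cball 0 (2 ^ Suc k)) x"
      using k2 True by (simp add: powr_powr mult.commute ennreal_leI)
    also have "\<dots> \<le> (\<Sum>k. ennreal (2 powr (- ?P * real k)) * indicator (cball 0 (2 ^ Suc k)) x)"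
    proof -
      have summand: "h k \<le> suminf h" for h :: "nat \<Rightarrow> ennreal"
        using sum_le_suminf[of h "{k}"] by simp
      show ?thesis
        by (rule summand[of "\<lambda>k. ennreal (2 powr (- ?P * real k)) * indicator (cball 0 (2 ^ Suc k)) x"])
    qed
    finally show ?thesis .
  qed simp
  have term_eq: "ennreal (2 powr (- ?P * real k)) * emeasure lborel (cball (0::'a) (2 ^ Suc k))
      = ennreal (?V * 2 ^ DIM('a) * ?q ^ k)" for k
  proof -
    have "2 powr (- ?P * real k) * (2 ^ Suc k) ^ DIM('a) = 2 ^ DIM('a) * (2 powr (- \<alpha>)) ^ k"
    proof -
      have "(2 ^ Suc k) ^ DIM('a) = (2 ^ DIM('a) * 2 powr (real DIM('a) * real k) :: real)"
        by (simp add: power_mult_distrib power_mult[symmetric] powr_realpow[symmetric] powr_powr mult.commute)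
      moreover have "2 powr (- ?P * real k) * 2 powr (real DIM('a) * real k) = (2::real) powr (- \<alpha> * real k)"
        by (simp add: powr_add[symmetric] algebra_simps)
      moreover have "2 powr (- \<alpha> * real k) = ((2::real) powr (- \<alpha>)) ^ k"
        by (subst powr_realpow[symmetric]) (simp_all add: powr_powr)
      ultimately show ?thesis by simp
    qed
    then have "2 powr (- ?P * real k) * (?V * (2 ^ Suc k) ^ DIM('a)) = ?V * 2 ^ DIM('a) * ?q ^ k"
      by (simp only: mult.left_commute[of _ ?V] mult.assoc)
    then show ?thesis
      by (subst emeasure_cball) (simp, simp only: ennreal_mult'[symmetric] powr_ge_zero)
  qed
  have q: "0 \<le> ?q" "?q < 1"
    using assms powr_less_mono[of "- \<alpha>" 0 2] by simp_all
  have "(\<integral>\<^sup>+ (x::'a). ennreal (norm x powr (- ?P) * of_bool (1 \<le> norm x)) \<partial>lborel)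
    \<le> (\<integral>\<^sup>+ (x::'a). (\<Sum>k. ennreal (2 powr (- ?P * real k)) * indicator (cball 0 (2 ^ Suc k)) x) \<partial>lborel)"
    by (rule nn_integral_mono) (rule pw)
  also have "\<dots> = (\<Sum>k. \<integral>\<^sup>+ (x::'a). ennreal (2 powr (- ?P * real k)) * indicator (cball 0 (2 ^ Suc k)) x \<partial>lborel)"
  proof (rule nn_integral_suminf)
    fix k
    have "cball (0::'a) (2 ^ Suc k) \<in> sets lborel"
      by (simp only: sets_lborel borel_closed closed_cball)
    then show "(\<lambda>x. ennreal (2 powr (- ?P * real k)) * indicator (cball (0::'a) (2 ^ Suc k)) x) \<in> borel_measurable lborel"
      by (intro borel_measurable_times_ennreal borel_measurable_const borel_measurable_indicator)
  qed
  also have "\<dots> = (\<Sum>k. ennreal (?V * 2 ^ DIM('a) * ?q ^ k))"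
  proof (rule suminf_cong)
    fix k
    have "(\<integral>\<^sup>+ (x::'a). ennreal (2 powr (- ?P * real k)) * indicator (cball 0 (2 ^ Suc k)) x \<partial>lborel)
      = ennreal (2 powr (- ?P * real k)) * emeasure lborel (cball (0::'a) (2 ^ Suc k))"
      by (rule nn_integral_cmult_indicator) (simp only: sets_lborel borel_closed closed_cball)
    then show "(\<integral>\<^sup>+ (x::'a). ennreal (2 powr (- ?P * real k)) * indicator (cball 0 (2 ^ Suc k)) x \<partial>lborel)
      = ennreal (?V * 2 ^ DIM('a) * ?q ^ k)"
      unfolding term_eq .
  qed
  also have "\<dots> = ennreal (\<Sum>k. ?V * 2 ^ DIM('a) * ?q ^ k)"
  proof (rule suminf_ennreal2)
    show "0 \<le> ?V * 2 ^ DIM('a) * ?q ^ k" for k by simp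
    show "summable (\<lambda>k. ?V * 2 ^ DIM('a) * ?q ^ k)"
      by (intro summable_mult summable_geometric) (use q in simp)
  qed
  also have "\<dots> < \<infinity>"
    by (simp only: infinity_ennreal_def ennreal_less_top)
  finally show ?thesis .
qed

text \<open>The growth of \<open>f\<close> gives
  \<open>c * (2 * R) powr (d + \<alpha>) \<le> exp (f R)\<close> at every radius, hence a global
  lower bound for the symmetrized weight. The weight \<omega> is \<open>C * w\<close> outside radius
  \<open>T\<close> and constant inside. The comparison constant \<open>C\<^sub>0\<close> allows the
  tail to begin at \<open>\<kappa> * t\<close> although \<omega> is minimized only over norms at
  least \<open>t\<close>.\<close>

lemma super_poincare_radial:
  fixes F :: "'a::euclidean_space \<Rightarrow> real" and f w :: "real \<Rightarrow> real"
  assumes isotropic: "\<And>x. F x = f (norm x)" and cont: "continuous_on UNIV f"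
    and prob: "prob_space (gibbs F)" and \<alpha>: "0 < \<alpha>"
    and w [measurable]: "w \<in> borel_measurable borel" and R0: "1 \<le> R\<^sub>0"
    and w_pos: "\<And>R. R\<^sub>0 \<le> R \<Longrightarrow> 0 < w R"
    and growth: "\<And>R S. R\<^sub>0 \<le> R \<Longrightarrow> R \<le> S \<Longrightarrow> (real DIM('a) + \<alpha>) * ln (S / R) \<le> f S - f R"
    and c1: "0 < c\<^sub>1" "\<And>R. R\<^sub>0 \<le> R \<Longrightarrow> (2 * R) powr (real DIM('a) + \<alpha>) * exp (- f R) * w R \<le> c\<^sub>1"
    and \<kappa>: "0 < \<kappa>" "\<kappa> \<le> 1"
    and C0: "0 < C\<^sub>0" "\<And>R. R\<^sub>0 \<le> R \<Longrightarrow> w (R / \<kappa>) \<le> C\<^sub>0 * w R"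
    and gap: "\<And>t R. R\<^sub>0 \<le> R \<Longrightarrow> R \<le> 3 / 2 * (\<kappa> * t) \<Longrightarrow>
      (4 / unit_ball_vol (real DIM('a)) + 1) * exp (f R) \<le> exp (f (2 * t))"
  shows "\<exists>C>0. \<exists>\<omega>. \<omega> \<in> borel_measurable borel \<and> (\<forall>x. 0 < \<omega> x) \<and> integrable (gibbs F) \<omega> \<and>
    (\<forall>\<^sub>F x in at_infinity. \<omega> x = C * w (norm x)) \<and> super_poincare F \<alpha> (super_rate F \<alpha> \<omega>)"
proof -
  let ?P = "real DIM('a) + \<alpha>"
  define K where "K = 4 / unit_ball_vol (real DIM('a)) + 1"
  have K: "0 < K" by (simp add: K_def add_pos_pos add_nonneg_pos)
  have [measurable]: "F \<in> borel_measurable borel"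
    using isotropic cont by (rule borel_measurable_radial)
  interpret prob_space "gibbs F" by fact
  obtain B where B: "\<And>R. 0 \<le> R \<Longrightarrow> R \<le> R\<^sub>0 \<Longrightarrow> \<bar>f R\<bar> \<le> B"
  proof -
    have "compact (f ` {0..R\<^sub>0})"
      by (intro compact_continuous_image continuous_on_subset[OF cont]) auto
    then have "bounded (f ` {0..R\<^sub>0})" by (rule compact_imp_bounded)
    then obtain B where "\<forall>y\<in>f ` {0..R\<^sub>0}. norm y \<le> B" unfolding bounded_iff by blast
    then show thesis using that[of B] by auto
  qed
  \<comment> \<open>Chosen so that the bound holds up to \<open>R\<^sub>0\<close> by compactness;
    from there \<open>growth\<close> propagates it outward.\<close>
  define c where "c = exp (- B) / (2 * R\<^sub>0) powr ?P"
  have c: "0 < c" using R0 by (simp add: c_def)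
  have low: "c * (2 * R) powr ?P \<le> exp (f R)" if "0 \<le> R" for R
  proof (cases "R \<le> R\<^sub>0")
    case True
    have "c * (2 * R) powr ?P \<le> c * (2 * R\<^sub>0) powr ?P"
      using c True that \<alpha> by (intro mult_left_mono powr_mono2) auto
    also have "\<dots> = exp (- B)" using R0 by (simp add: c_def)
    also have "\<dots> \<le> exp (f R)" using B[OF that True] by simp
    finally show ?thesis .
  next
    case False
    have "c * (2 * R) powr ?P = exp (- B) * (R / R\<^sub>0) powr ?P"
      using R0 False by (simp add: c_def powr_mult powr_divide)
    also have "\<dots> = exp (- B + ?P * ln (R / R\<^sub>0))"
      using R0 False by (simp add: powr_def exp_add[symmetric])
    also have "\<dots> \<le> exp (f R)"
      using growth[of R\<^sub>0 R] B[of R\<^sub>0] R0 False by simp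
    finally show ?thesis .
  qed
  have diagonal: "c \<le> (exp (F x) + exp (F y)) * norm (x - y) powr (- ?P)" if "x \<noteq> y" for x y
  proof -
    \<comment> \<open>The distance is at most twice the larger norm, and for a radial potential the
      term of the point with that norm alone is large enough.\<close>
    define m where "m = max (norm x) (norm y)"
    have "norm (x - y) \<le> 2 * m"
      using norm_triangle_ineq4[of x y] by (simp add: m_def)
    then have "norm (x - y) powr ?P \<le> (2 * m) powr ?P"
      using \<alpha> by (intro powr_mono2) auto
    then have "c * norm (x - y) powr ?P \<le> c * (2 * m) powr ?P"
      using c by (intro mult_left_mono) auto
    also have "\<dots> \<le> exp (f m)" by (rule low) (simp add: m_def le_max_iff_disj)
    also have "\<dots> \<le> exp (F x) + exp (F y)" by (simp add: m_def isotropic max_def)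
    finally have "c * norm (x - y) powr ?P \<le> exp (F x) + exp (F y)" .
    then have "c \<le> (exp (F x) + exp (F y)) / norm (x - y) powr ?P"
      using that by (simp add: pos_le_divide_eq)
    then show ?thesis by (simp only: powr_minus divide_inverse)
  qed
  obtain p where p: "emeasure (gibbs F) (ball 0 1) = ennreal p" "0 < p"
    by (rule measure_gibbs_ball_pos[of F 1]) (use prob in auto)
  \<comment> \<open>The three inner entries are the constants that
    \<open>c * t powr \<alpha>\<close> must dominate: the gap over the ball of radius
    \<open>R\<^sub>0\<close>, the volume condition, and the bound on the averaging radius. The
    threshold \<open>T\<close> ensures \<open>t powr \<alpha> \<ge> Q\<close> from there on, and
    \<open>R\<^sub>0 \<le> \<kappa> * T\<close>.\<close>
  define Q where "Q = max 1 (max (K * exp B / c) (max (4 / p / c) (exp (F 0) / ((\<kappa> / 2) powr \<alpha> * c))))"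
  define T where "T = max (R\<^sub>0 / \<kappa>) (Q powr (1 / \<alpha>))"
  have Q: "1 \<le> Q" "K * exp B \<le> c * Q" "4 / p \<le> c * Q" "exp (F 0) \<le> (\<kappa> / 2) powr \<alpha> * c * Q"
  proof -
    show "1 \<le> Q" by (simp add: Q_def)
    have "K * exp B / c \<le> Q" "4 / p / c \<le> Q" "exp (F 0) / ((\<kappa> / 2) powr \<alpha> * c) \<le> Q"
      unfolding Q_def by (simp_all only: le_max_iff_disj order_refl simp_thms)
    then show "K * exp B \<le> c * Q" "4 / p \<le> c * Q" "exp (F 0) \<le> (\<kappa> / 2) powr \<alpha> * c * Q"
      using c \<kappa> by (simp_all only: pos_divide_le_eq mult_pos_pos powr_gt_zero mult.commute)
  qed
  have T: "R\<^sub>0 \<le> \<kappa> * T" "1 \<le> T"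
  proof -
    have "R\<^sub>0 / \<kappa> \<le> T" by (simp add: T_def)
    then show *: "R\<^sub>0 \<le> \<kappa> * T" using \<kappa> by (simp add: pos_divide_le_eq mult.commute)
    have "\<kappa> * T \<le> 1 * T" using * \<kappa> R0 by (intro mult_right_mono) (auto simp: T_def le_max_iff_disj)
    then show "1 \<le> T" using * R0 by linarith
  qed
  have RT: "R\<^sub>0 \<le> T"
    using T \<kappa> mult_right_mono[of \<kappa> 1 T] by linarith
  have large: "Q \<le> t powr \<alpha>" if "T \<le> t" for t
  proof -
    have "Q = (Q powr (1 / \<alpha>)) powr \<alpha>" using Q \<alpha> by (simp add: powr_powr)
    also have "\<dots> \<le> t powr \<alpha>" using that \<alpha> by (intro powr_mono2) (auto simp: T_def)
    finally show ?thesis .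
  qed
  obtain pT where pT: "emeasure (gibbs F) (ball 0 T) = ennreal pT" "0 < pT"
    by (rule measure_gibbs_ball_pos[of F T]) (use prob T in auto)
  \<comment> \<open>The ball of radius \<open>T\<close> then contributes
    \<open>C * A * pT = C * w T\<close> to the integral of \<omega>, which is the value of \<omega>
    on the sphere of radius \<open>T\<close>, as \<open>small\<close> demands.\<close>
  define A where "A = w T / pT"
  have A: "0 < A" using w_pos[OF RT] pT by (simp add: A_def)
  \<comment> \<open>The first entry keeps \<omega> below \<open>2 * c\<close> on the sphere of
    radius \<open>T\<close>; the second makes the tail condition hold with the mass \<open>p\<close>
    of the unit ball.\<close>
  define C where "C = min (2 * c / w T) (2 * p / (c\<^sub>1 * C\<^sub>0))"
  have C: "0 < C" "C * w T \<le> 2 * c" "C * (c\<^sub>1 * C\<^sub>0) \<le> 2 * p"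
  proof -
    show "0 < C" using c w_pos[OF RT] p c1(1) C0(1) by (simp add: C_def)
    have "C \<le> 2 * c / w T" "C \<le> 2 * p / (c\<^sub>1 * C\<^sub>0)" by (simp_all add: C_def)
    then show "C * w T \<le> 2 * c" "C * (c\<^sub>1 * C\<^sub>0) \<le> 2 * p"
      using w_pos[OF RT] c1(1) C0(1) by (simp_all only: pos_le_divide_eq mult_pos_pos)
  qed
  define \<omega> :: "'a \<Rightarrow> real" where "\<omega> x = C * (if norm x < T then A else w (norm x))" for x
  have \<omega>_out: "\<omega> x = C * w (norm x)" if "T \<le> norm x" for x
    using that by (simp add: \<omega>_def)
  have \<omega>_pos: "0 < \<omega> x" for x
    using C(1) A w_pos RT by (simp add: \<omega>_def)
  have [measurable]: "\<omega> \<in> borel_measurable borel"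
    unfolding \<omega>_def by measurable
  have int: "integrable (gibbs F) \<omega>"
  proof (rule integrableI_nonneg)
    \<comment> \<open>Outside radius \<open>T\<close> the bound \<open>c1\<close> says that
      \<open>w\<close> is at most a multiple of \<open>exp F\<close> times an integrable power of
      the norm; the exponential cancels against the density.\<close>
    have pw: "ennreal (\<omega> x) \<le> ennreal (C * A) + ennreal (C * c\<^sub>1) * ennreal (exp (F x) * (norm x powr (- ?P) * of_bool (1 \<le> norm x)))" for x
    proof (cases "norm x < T")
      case True
      then show ?thesis by (simp add: \<omega>_def)
    next
      case False
      then have nx: "R\<^sub>0 \<le> norm x" "1 \<le> norm x" using RT R0 by auto
      have "norm x powr ?P * exp (- F x) * w (norm x) \<le> (2 * norm x) powr ?P * exp (- f (norm x)) * w (norm x)"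
        unfolding isotropic using nx w_pos[OF nx(1)] \<alpha> by (intro mult_right_mono powr_mono2) auto
      also have "\<dots> \<le> c\<^sub>1" by (rule c1(2)[OF nx(1)])
      finally have "(norm x powr ?P * exp (- F x) * w (norm x)) * (exp (F x) * norm x powr (- ?P))
          \<le> c\<^sub>1 * (exp (F x) * norm x powr (- ?P))"
        by (rule mult_right_mono) simp
      moreover have "(norm x powr ?P * exp (- F x) * w (norm x)) * (exp (F x) * norm x powr (- ?P)) = w (norm x)"
        using nx by (simp only: powr_minus exp_minus) (auto simp add: field_simps)
      ultimately have "w (norm x) \<le> c\<^sub>1 * (exp (F x) * norm x powr (- ?P))" by (simp only:)
      then have "C * w (norm x) \<le> C * (c\<^sub>1 * (exp (F x) * norm x powr (- ?P)))"
        using C by (intro mult_left_mono) auto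
      then have "ennreal (\<omega> x) \<le> ennreal (C * (c\<^sub>1 * (exp (F x) * norm x powr (- ?P))))"
        using \<omega>_out[of x] False by (intro ennreal_leI) simp
      also have "\<dots> = ennreal (C * c\<^sub>1) * ennreal (exp (F x) * (norm x powr (- ?P) * of_bool (1 \<le> norm x)))"
        using C(1) c1(1) nx(2) by (subst ennreal_mult[symmetric]) (simp_all add: mult.assoc)
      finally show ?thesis by (rule order_trans) simp
    qed
    have "(\<integral>\<^sup>+ x. ennreal (\<omega> x) \<partial>gibbs F) \<le> (\<integral>\<^sup>+ x. (ennreal (C * A) + ennreal (C * c\<^sub>1)
        * ennreal (exp (F x) * (norm x powr (- ?P) * of_bool (1 \<le> norm x)))) \<partial>gibbs F)"
      by (rule nn_integral_mono) (rule pw)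
    also have "\<dots> = ennreal (C * A) + ennreal (C * c\<^sub>1)
        * (\<integral>\<^sup>+ x. ennreal (exp (F x) * (norm x powr (- ?P) * of_bool (1 \<le> norm x))) \<partial>gibbs F)"
      using emeasure_space_1 by (simp add: nn_integral_add nn_integral_cmult)
    also have "(\<integral>\<^sup>+ x. ennreal (exp (F x) * (norm x powr (- ?P) * of_bool (1 \<le> norm x))) \<partial>gibbs F)
      = (\<integral>\<^sup>+ (x::'a). ennreal (norm x powr (- ?P) * of_bool (1 \<le> norm x)) \<partial>lborel)"
    proof (subst nn_integral_gibbs)
      show "(\<integral>\<^sup>+ x. ennreal (exp (- F x)) * ennreal (exp (F x) * (norm x powr (- ?P) * of_bool (1 \<le> norm x))) \<partial>lborel)
        = (\<integral>\<^sup>+ (x::'a). ennreal (norm x powr (- ?P) * of_bool (1 \<le> norm x)) \<partial>lborel)"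
      proof (rule nn_integral_cong)
        have "ennreal (exp (- F x)) * ennreal (exp (F x) * y) = ennreal y" if "0 \<le> y" for x y
          using that by (subst ennreal_mult[symmetric]) (simp_all add: exp_minus)
        then show "ennreal (exp (- F x)) * ennreal (exp (F x) * (norm x powr (- ?P) * of_bool (1 \<le> norm x)))
          = ennreal (norm x powr (- ?P) * of_bool (1 \<le> norm x))" for x by simp
      qed
    qed measurable
    also have "ennreal (C * A) + ennreal (C * c\<^sub>1) * \<dots> < \<infinity>"
      using nn_integral_norm_powr_lt_top[OF \<alpha>, where 'a = 'a]
      by (simp add: ennreal_mult_less_top)
    finally show "(\<integral>\<^sup>+ x. ennreal (\<omega> x) \<partial>gibbs F) < \<infinity>" .
  qed (use \<omega>_pos in \<open>auto intro: less_imp_le\<close>)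
  have "super_poincare F \<alpha> (super_rate F \<alpha> \<omega>)"
  proof (rule super_poincare_super_rate[OF _ prob \<alpha> \<omega>_pos p c diagonal \<kappa>])
    show "1 \<le> \<kappa> * T" using T R0 by simp
  next
    fix t :: real assume t: "0 < t" "t < T"
    obtain x :: 'a where x: "norm x = T" using vector_choose_size[of T] T by auto
    have "ennreal (\<omega> x) = ennreal (C * A) * emeasure (gibbs F) (ball 0 T)"
    proof -
      have "\<omega> x = C * A * pT" using x pT(2) by (simp add: \<omega>_def A_def)
      then show ?thesis
        unfolding pT(1) using pT(2) C(1) A by (simp add: ennreal_mult)
    qed
    also have "\<dots> = (\<integral>\<^sup>+ x. ennreal (C * A) * indicator (ball 0 T) x \<partial>gibbs F)"
      by (rule nn_integral_cmult_indicator[symmetric]) simp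
    also have "\<dots> \<le> (\<integral>\<^sup>+ x. ennreal (\<omega> x) \<partial>gibbs F)"
      by (intro nn_integral_mono) (auto simp: \<omega>_def indicator_def)
    also have "\<dots> \<le> 2 * (\<integral>\<^sup>+ x. ennreal (\<omega> x) \<partial>gibbs F)"
      by (simp add: mult_2)
    finally show "\<exists>x. t \<le> norm x \<and> \<omega> x \<le> 2 * c \<and> ennreal (\<omega> x) \<le> 2 * (\<integral>\<^sup>+ x. ennreal (\<omega> x) \<partial>gibbs F)"
      using x t C(2) \<omega>_out[of x] by (intro exI[of _ x]) auto
  next
    fix t and x :: 'a assume t: "T \<le> t" and x: "\<kappa> * t \<le> norm x"
    \<comment> \<open>Stretching \<open>x\<close> by \<open>1 / \<kappa>\<close> brings its norm
      from at least \<open>\<kappa> * t\<close> to at least \<open>t\<close>;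
      \<open>C\<^sub>0\<close> is the price for evaluating \<open>w\<close> there.\<close>
    let ?z = "(1 / \<kappa>) *\<^sub>R x"
    have nz: "norm ?z = norm x / \<kappa>" using \<kappa> by simp
    have tz: "t \<le> norm ?z" unfolding nz using x \<kappa> by (simp add: pos_le_divide_eq mult.commute)
    have "\<kappa> * T \<le> \<kappa> * t" using t \<kappa> by (intro mult_left_mono) auto
    then have Rx: "R\<^sub>0 \<le> norm x" using x T by linarith
    have "\<omega> ?z = C * w (norm x / \<kappa>)" unfolding nz[symmetric] by (rule \<omega>_out) (use tz t in linarith)
    also have "\<dots> \<le> C * (C\<^sub>0 * w (norm x))" using C0(2)[OF Rx] C(1) by (intro mult_left_mono) auto
    finally have "(2 * norm x) powr ?P * exp (- F x) * \<omega> ?z \<le> (2 * norm x) powr ?P * exp (- F x) * (C * (C\<^sub>0 * w (norm x)))"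
      by (rule mult_left_mono) simp
    also have "\<dots> = C * C\<^sub>0 * ((2 * norm x) powr ?P * exp (- f (norm x)) * w (norm x))"
      by (simp add: isotropic)
    also have "\<dots> \<le> C * C\<^sub>0 * c\<^sub>1"
      using c1(2)[OF Rx] C(1) C0(1) by (intro mult_left_mono) auto
    also have "\<dots> \<le> 2 * p" using C(3) by (simp add: ac_simps)
    finally show "\<exists>z. t \<le> norm z \<and> (2 * norm x) powr ?P * exp (- F x) * \<omega> z \<le> 2 * p"
      using tz by blast
  next
    fix t assume t: "T \<le> t"
    obtain z :: 'a where z: "norm z = 2 * t" using vector_choose_size[of "2 * t"] T t by auto
    have t1: "1 \<le> t" using T t by simp
    have td: "1 \<le> t ^ DIM('a)" "t \<le> t ^ DIM('a)"
      using t1 by (simp_all add: one_le_power self_le_power)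
    \<comment> \<open>The growth exponent exceeds the dimension by \<alpha>; the surplus
      \<open>t powr \<alpha> \<ge> Q\<close> pays for every constant below.\<close>
    have "c * (t ^ DIM('a) * t powr \<alpha>) = c * t powr ?P"
      using t1 by (simp add: powr_add powr_realpow)
    also have "\<dots> \<le> c * (2 * (2 * t)) powr ?P"
      using c t1 \<alpha> by (intro mult_left_mono powr_mono2) auto
    also have "\<dots> \<le> exp (F z)"
      using low[of "2 * t"] t1 by (simp add: isotropic z)
    finally have ge: "c * (t ^ DIM('a) * t powr \<alpha>) \<le> exp (F z)" .
    have gap': "K * exp (F x) \<le> exp (F z)" if "norm x \<le> 3 / 2 * (\<kappa> * t)" for x
    proof (cases "R\<^sub>0 \<le> norm x")
      case True
      then show ?thesis using gap[OF True that] by (simp add: isotropic z K_def)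
    next
      case False
      then have "K * exp (F x) \<le> K * exp B"
        using B[of "norm x"] K by (intro mult_left_mono) (auto simp: isotropic)
      also have "\<dots> \<le> c * Q" by (rule Q)
      also have "\<dots> \<le> c * (1 * t powr \<alpha>)" using large[OF t] c by (intro mult_left_mono) auto
      also have "\<dots> \<le> c * (t ^ DIM('a) * t powr \<alpha>)"
        using td c by (intro mult_left_mono mult_right_mono) auto
      finally show ?thesis using ge by linarith
    qed
    have "4 / p * t ^ DIM('a) \<le> c * t powr \<alpha> * t ^ DIM('a)"
      using t1 Q(3) large[OF t] c by (intro mult_right_mono order_trans[OF Q(3)] mult_left_mono) auto
    then have vol: "4 / p * t ^ DIM('a) \<le> exp (F z)"
      using ge by (simp add: ac_simps)
    have "t * exp (F 0) \<le> t ^ DIM('a) * ((\<kappa> / 2) powr \<alpha> * c * t powr \<alpha>)"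
    proof (rule mult_mono)
      have "(\<kappa> / 2) powr \<alpha> * c * Q \<le> (\<kappa> / 2) powr \<alpha> * c * t powr \<alpha>"
        using large[OF t] c by (intro mult_left_mono) auto
      then show "exp (F 0) \<le> (\<kappa> / 2) powr \<alpha> * c * t powr \<alpha>" using Q(4) by linarith
    qed (use td t1 in auto)
    also have "\<dots> = (\<kappa> / 2) powr \<alpha> * (c * (t ^ DIM('a) * t powr \<alpha>))" by simp
    also have "\<dots> \<le> (\<kappa> / 2) powr \<alpha> * exp (F z)"
      using ge by (intro mult_left_mono) auto
    also have "\<dots> \<le> (\<kappa> * t / 2) powr \<alpha> * exp (F z)"
      using t1 \<kappa> \<alpha> by (intro mult_right_mono powr_mono2) auto
    finally show "\<exists>z. norm z \<le> 2 * t
      \<and> (\<forall>x. norm x \<le> 3 / 2 * (\<kappa> * t) \<longrightarrow> (4 / unit_ball_vol (real DIM('a)) + 1) * exp (F x) \<le> exp (F z))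
      \<and> 4 / p * t ^ DIM('a) \<le> exp (F z) \<and> t * exp (F 0) \<le> (\<kappa> * t / 2) powr \<alpha> * exp (F z)"
      using z gap' vol unfolding K_def by (intro exI[of _ z]) auto
  qed auto
  moreover have "\<forall>\<^sub>F x in at_infinity. \<omega> x = C * w (norm x)"
    unfolding eventually_at_infinity using \<omega>_out by blast
  ultimately show ?thesis
    using C(1) \<omega>_pos int by (intro exI[of _ C] conjI exI[of _ \<omega>]) auto
qed

subsection \<open>Slope of the profile in logarithmic scale\<close>

lemma filterlim_powr_at_top:
  assumes "0 < (s::real)"
  shows "filterlim (\<lambda>x. x powr s) at_top at_top"
  unfolding filterlim_at_top
proof
  fix Z :: real
  show "\<forall>\<^sub>F x in at_top. Z \<le> x powr s"
    using eventually_ge_at_top[of "max Z 1 powr (1 / s)"]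
  proof eventually_elim
    case (elim x)
    have "Z \<le> (max Z 1 powr (1 / s)) powr s" using assms by (simp add: powr_powr)
    also have "\<dots> \<le> x powr s" using elim assms by (intro powr_mono2) auto
    finally show ?case .
  qed
qed

lemma DERIV_psi:
  assumes "0 < r"
  shows "(psi b \<beta> has_real_derivative b * \<beta> * r powr (\<beta> - 1) * psi b \<beta> r) (at r)"
proof -
  have "psi b \<beta> = (\<lambda>r. exp (b * r powr \<beta>))" by (simp add: psi_def fun_eq_iff)
  moreover have "((\<lambda>r. exp (b * r powr \<beta>)) has_real_derivative b * \<beta> * r powr (\<beta> - 1) * exp (b * r powr \<beta>)) (at r)"
    using assms by (auto intro!: derivative_eq_intros)
  ultimately show ?thesis by simp
qed

lemma deriv_psi: "0 < r \<Longrightarrow> deriv (psi b \<beta>) r = b * \<beta> * r powr (\<beta> - 1) * psi b \<beta> r"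
  by (rule DERIV_imp_deriv[OF DERIV_psi])

text \<open>The second derivative stays symbolic, because the convexity assumption mentions it in
  that form; only its existence has to be shown.\<close>

lemma DERIV_deriv_psi:
  assumes "0 < r"
  shows "(deriv (psi b \<beta>) has_real_derivative deriv (deriv (psi b \<beta>)) r) (at r)"
proof -
  have "\<exists>D. ((\<lambda>r. b * \<beta> * r powr (\<beta> - 1) * psi b \<beta> r) has_real_derivative D) (at r)"
    using assms by (intro exI) (auto intro!: derivative_eq_intros DERIV_psi)
  then obtain D where "((\<lambda>r. b * \<beta> * r powr (\<beta> - 1) * psi b \<beta> r) has_real_derivative D) (at r)" ..
  then have "(deriv (psi b \<beta>) has_real_derivative D) (at r)"
    by (rule has_field_derivative_transform_within_open[of _ _ _ "{0<..}"])
       (use assms in \<open>auto simp: deriv_psi\<close>)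
  then show ?thesis by (simp add: DERIV_imp_deriv)
qed

lemma C2_profile_DERIV:
  assumes "C2_profile f"
  shows "(f has_real_derivative deriv f x) (at x)" "(deriv f has_real_derivative deriv (deriv f) x) (at x)"
  using assms unfolding C2_profile_def differentiable_on_def
  by (auto intro!: DERIV_deriv_iff_real_differentiable[THEN iffD2])

text \<open>For \<open>r \<ge> 2\<close> the base is at most half the square of \<open>r\<close>,
  which leaves a constant factor above the plain power, strictly above 1 when \<theta> is
  positive.\<close>

lemma weight_powr_le:
  fixes r \<theta> :: real
  assumes "2 \<le> r" "0 \<le> \<theta>"
  shows "2 powr (\<theta> / 2) * r powr (- \<theta>) \<le> 1 / (1 + 1 / 4 * r\<^sup>2) powr (\<theta> / 2)"
proof -
  have "2 * 2 \<le> r * r" using assms by (intro mult_mono) auto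
  then have "1 + 1 / 4 * r\<^sup>2 \<le> r\<^sup>2 / 2" by (simp add: power2_eq_square)
  moreover have "0 < 1 + 1 / 4 * r\<^sup>2" by (simp add: add_pos_nonneg)
  ultimately have "(1 + 1 / 4 * r\<^sup>2) powr (\<theta> / 2) \<le> (r\<^sup>2 / 2) powr (\<theta> / 2)"
    using assms by (intro powr_mono2) auto
  also have "\<dots> = r powr \<theta> / 2 powr (\<theta> / 2)"
    using assms by (simp add: powr_divide powr_powr flip: powr_numeral)
  finally have "1 / (r powr \<theta> / 2 powr (\<theta> / 2)) \<le> 1 / (1 + 1 / 4 * r\<^sup>2) powr (\<theta> / 2)"
    using assms \<open>0 < 1 + 1 / 4 * r\<^sup>2\<close>
    by (intro divide_left_mono mult_pos_pos divide_pos_pos) auto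
  then show ?thesis by (simp add: powr_minus field_simps)
qed

text \<open>The right side, called \<open>H\<close>, is the derivative of f(\<psi>(r)) - b d
  r^\<beta> + (d - \<beta>) log r. The first convexity inequality bounds \<open>H r / r\<close> and
  yields the constant \<mu> at once; the second bounds the derivative of \<open>H\<close>, and
  integrating it yields \<mu> / (1 - \<theta>).\<close>

lemma slope_lower_bound:
  fixes f :: "real \<Rightarrow> real"
  assumes C2: "C2_profile f" and pos: "0 < \<mu>" "0 \<le> \<theta>" "\<theta> < 1" "0 < b"
    and convex1: "\<And>r. N < r \<Longrightarrow> 0 < r \<Longrightarrow>
      deriv f (psi b \<beta> r) * deriv (psi b \<beta>) r * r powr (- 1)
        - b * \<beta> * d * r powr (\<beta> - 2) + (d - \<beta>) * r powr (- 2)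
      > \<mu> / (1 + 1 / 4 * r\<^sup>2) powr (\<theta> / 2)"
    and convex2: "\<And>r. N < r \<Longrightarrow> 0 < r \<Longrightarrow>
      deriv (deriv f) (psi b \<beta> r) * (deriv (psi b \<beta>) r)\<^sup>2
        + deriv f (psi b \<beta> r) * deriv (deriv (psi b \<beta>)) r
        - b * \<beta> * (\<beta> - 1) * d * r powr (\<beta> - 2) - (d - \<beta>) * r powr (- 2)
      > \<mu> / (1 + 1 / 4 * r\<^sup>2) powr (\<theta> / 2)"
    and B: "B = \<mu> \<or> B = \<mu> / (1 - \<theta>)"
  shows "\<forall>\<^sub>F r in at_top. B * r powr (1 - \<theta>)
    \<le> deriv f (psi b \<beta> r) * deriv (psi b \<beta>) r - b * \<beta> * d * r powr (\<beta> - 1) + (d - \<beta>) / r"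
proof -
  define H where "H r = deriv f (psi b \<beta> r) * deriv (psi b \<beta>) r - b * \<beta> * d * r powr (\<beta> - 1) + (d - \<beta>) / r" for r
  define k where "k = 2 powr (\<theta> / 2)"
  have k: "1 \<le> k" using pos by (simp add: k_def ge_one_powr_ge_zero)
  let ?r = "max 2 (N + 1)"
  have first: "\<mu> * r powr (1 - \<theta>) \<le> H r" if "?r \<le> r" for r
  proof -
    have r: "2 \<le> r" "N < r" "0 < r" using that by auto
    have "\<mu> * (1 * r powr (- \<theta>)) \<le> \<mu> * (k * r powr (- \<theta>))"
      using k pos by (intro mult_left_mono mult_right_mono) auto
    also have "\<dots> \<le> \<mu> * (1 / (1 + 1 / 4 * r\<^sup>2) powr (\<theta> / 2))"
      using weight_powr_le[OF r(1) pos(2)] pos by (intro mult_left_mono) (auto simp: k_def)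
    also have "\<dots> < deriv f (psi b \<beta> r) * deriv (psi b \<beta>) r * r powr (- 1)
        - b * \<beta> * d * r powr (\<beta> - 2) + (d - \<beta>) * r powr (- 2)"
      using convex1[OF r(2,3)] by simp
    also have "\<dots> = H r / r"
    proof -
      have "r powr (\<beta> - 2) = r powr (\<beta> - 1) / r"
        using r powr_diff[of r "\<beta> - 1" 1] by simp
      moreover have "r powr (- 1) = 1 / r" "r powr (- 2) = 1 / r / r"
        using r by (simp_all add: powr_minus_divide power2_eq_square)
      ultimately show ?thesis
        unfolding H_def by (simp add: diff_divide_distrib add_divide_distrib)
    qed
    finally have "\<mu> * r powr (- \<theta>) * r \<le> H r"
      using r by (simp add: field_simps)
    moreover have "r powr (1 - \<theta>) = r powr (- \<theta>) * r"
      using r powr_add[of r "- \<theta>" 1] by simp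
    ultimately show ?thesis by simp
  qed
  have "\<forall>\<^sub>F r in at_top. B * r powr (1 - \<theta>) \<le> H r"
  \<comment> \<open>For \<theta> = 0 the two values of \<open>B\<close> coincide, so in the second
    case \<theta> is positive, as the strict gain there requires.\<close>
  proof (cases "B = \<mu>")
    case True
    then show ?thesis
      using first unfolding eventually_at_top_linorder by blast
  next
    case False
    then have Beq: "B = \<mu> / (1 - \<theta>)" and "\<theta> \<noteq> 0" using B by auto
    then have \<theta>: "0 < \<theta>" using pos by simp
    \<comment> \<open>Bounding \<open>1 + r\<^sup>2 / 4\<close> by \<open>r\<^sup>2 / 2\<close> rather than \<open>r\<^sup>2\<close> gains the factor \<open>k > 1\<close>,
      which pays for the unknown constant of integration \<open>G ?r\<close>.\<close>
    have k1: "1 < k" using \<theta> by (simp add: k_def gr_one_powr)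
    define G where "G r = H r - k * B * r powr (1 - \<theta>)" for r
    have mono: "G ?r \<le> G r" if "?r \<le> r" for r
    proof (rule DERIV_nonneg_imp_nondecreasing[OF that])
      fix r assume "?r \<le> r"
      then have r: "2 \<le> r" "N < r" "0 < r" by auto
      let ?D = "deriv (deriv f) (psi b \<beta> r) * (deriv (psi b \<beta>) r)\<^sup>2
        + deriv f (psi b \<beta> r) * deriv (deriv (psi b \<beta>)) r
        - b * \<beta> * (\<beta> - 1) * d * r powr (\<beta> - 2) - (d - \<beta>) * r powr (- 2)"
      have psi': "(psi b \<beta> has_real_derivative deriv (psi b \<beta>) r) (at r)"
        using DERIV_psi[OF r(3)] by (simp add: deriv_psi r)
      have "((\<lambda>r. deriv f (psi b \<beta> r)) has_real_derivative
          deriv (deriv f) (psi b \<beta> r) * deriv (psi b \<beta>) r) (at r)"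
        by (rule DERIV_chain2[OF C2_profile_DERIV(2)[OF C2] psi'])
      from DERIV_mult[OF this DERIV_deriv_psi[OF r(3)]]
      have "((\<lambda>r. deriv f (psi b \<beta> r) * deriv (psi b \<beta>) r) has_real_derivative
         deriv (deriv f) (psi b \<beta> r) * (deriv (psi b \<beta>) r)\<^sup>2
         + deriv f (psi b \<beta> r) * deriv (deriv (psi b \<beta>)) r) (at r)"
        by (simp add: power2_eq_square algebra_simps)
      moreover have "((\<lambda>r. b * \<beta> * d * r powr (\<beta> - 1)) has_real_derivative
          b * \<beta> * (\<beta> - 1) * d * r powr (\<beta> - 2)) (at r)"
        using r by (auto intro!: derivative_eq_intros)
      moreover have "((\<lambda>r. (d - \<beta>) / r) has_real_derivative - (d - \<beta>) * r powr (- 2)) (at r)"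
        using r by (auto intro!: derivative_eq_intros simp: powr_minus_divide power2_eq_square)
      moreover have "((\<lambda>r. k * B * r powr (1 - \<theta>)) has_real_derivative k * \<mu> * r powr (- \<theta>)) (at r)"
        using r pos by (auto intro!: derivative_eq_intros simp: Beq)
      ultimately have "(G has_real_derivative (deriv (deriv f) (psi b \<beta> r) * (deriv (psi b \<beta>) r)\<^sup>2
         + deriv f (psi b \<beta> r) * deriv (deriv (psi b \<beta>)) r)
         - b * \<beta> * (\<beta> - 1) * d * r powr (\<beta> - 2) + - (d - \<beta>) * r powr (- 2) - k * \<mu> * r powr (- \<theta>)) (at r)"
        unfolding G_def H_def by (intro DERIV_diff DERIV_add)
      then have "(G has_real_derivative ?D - k * \<mu> * r powr (- \<theta>)) (at r)"
        by (rule DERIV_cong) (simp add: algebra_simps)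
      moreover have "0 \<le> ?D - k * \<mu> * r powr (- \<theta>)"
      proof -
        have "\<mu> * (k * r powr (- \<theta>)) \<le> \<mu> * (1 / (1 + 1 / 4 * r\<^sup>2) powr (\<theta> / 2))"
          using weight_powr_le[OF r(1) pos(2)] pos by (intro mult_left_mono) (auto simp: k_def)
        also have "\<dots> \<le> ?D" using convex2[OF r(2,3)] by simp
        finally show ?thesis by (simp add: mult.commute mult.left_commute)
      qed
      ultimately show "\<exists>y. (G has_real_derivative y) (at r) \<and> 0 \<le> y" by blast
    qed
    have kB: "0 < (k - 1) * B" using k1 pos by (simp add: Beq)
    \<comment> \<open>The exponent is positive, so the surplus
      \<open>(k - 1) * B * r powr (1 - \<theta>)\<close> eventually outweighs the initial value of
      \<open>G\<close>.\<close>
    have "\<forall>\<^sub>F r in at_top. - G ?r / ((k - 1) * B) \<le> r powr (1 - \<theta>)"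
      using filterlim_powr_at_top[of "1 - \<theta>"] pos by (simp add: filterlim_at_top)
    moreover have "\<forall>\<^sub>F r in at_top. ?r \<le> r" by (rule eventually_ge_at_top)
    ultimately show ?thesis
    proof eventually_elim
      case (elim r)
      have "- G ?r \<le> (k - 1) * B * r powr (1 - \<theta>)"
        using elim(1) kB by (simp only: pos_divide_le_eq mult.commute)
      moreover have "G ?r \<le> H r - k * B * r powr (1 - \<theta>)"
        using mono[OF elim(2)] by (simp add: G_def)
      ultimately show ?case by (simp add: algebra_simps)
    qed
  qed
  then show ?thesis by (simp add: H_def)
qed

text \<open>Substitute L = b r^\<beta>, so that \<psi>(r) = exp L, and divide by dL/dr = b \<beta>
  r^(\<beta> - 1). The right side is the slope of L \<mapsto> f(exp L). The constants
  \<open>a\<close> and \<open>q\<close> arise because B r^(2 - \<theta>) / (2 - \<theta>), an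
  antiderivative of the slope bound, equals a L^q.\<close>

lemma log_slope_lower_bound:
  fixes f :: "real \<Rightarrow> real"
  assumes pos: "\<theta> < 2" "0 < b" "0 < \<beta>"
    and slope: "\<forall>\<^sub>F r in at_top. B * r powr (1 - \<theta>)
      \<le> deriv f (psi b \<beta> r) * deriv (psi b \<beta>) r - b * \<beta> * d * r powr (\<beta> - 1) + (d - \<beta>) / r"
    and q: "q = (2 - \<theta>) / \<beta>" and a: "a = B / (2 - \<theta>) * b powr (- q)"
  shows "\<forall>\<^sub>F L in at_top. d - (d - \<beta>) / \<beta> / L + a * q * L powr (q - 1) \<le> deriv f (exp L) * exp L"
proof -
  have lim: "filterlim (\<lambda>L. (L / b) powr (1 / \<beta>)) at_top at_top"
  proof (rule filterlim_compose[OF filterlim_powr_at_top])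
    show "filterlim (\<lambda>L. L / b) at_top at_top"
      unfolding filterlim_at_top using pos
      by (simp add: pos_le_divide_eq eventually_ge_at_top)
  qed (use pos in simp)
  show ?thesis
    using eventually_compose_filterlim[OF slope lim] eventually_gt_at_top[of 0]
  proof eventually_elim
    case (elim L)
    define r where "r = (L / b) powr (1 / \<beta>)"
    have r: "0 < r" using elim pos by (simp add: r_def)
    have rb: "r powr \<beta> = L / b" using elim pos by (simp add: r_def powr_powr)
    have psi: "psi b \<beta> r = exp L" using pos by (simp add: psi_def rb)
    have split: "r powr \<beta> = r powr (\<beta> - 1) * r"
      using r powr_add[of r "\<beta> - 1" 1] by simp
    let ?x = "b * \<beta> * r powr (\<beta> - 1)"
    have x: "0 < ?x" using r pos by simp
    have "B * r powr (1 - \<theta>) + ?x * d - (d - \<beta>) / r \<le> deriv f (exp L) * exp L * ?x"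
      using elim(1) r unfolding r_def[symmetric] by (simp add: deriv_psi psi algebra_simps)
    then have "(B * r powr (1 - \<theta>) + ?x * d - (d - \<beta>) / r) / ?x \<le> deriv f (exp L) * exp L"
      using x by (simp only: pos_divide_le_eq)
    moreover have "(B * r powr (1 - \<theta>) + ?x * d - (d - \<beta>) / r) / ?x
      = d - (d - \<beta>) / \<beta> / L + a * q * L powr (q - 1)"
    proof -
      have "(B * r powr (1 - \<theta>) + ?x * d - (d - \<beta>) / r) / ?x
        = B * r powr (1 - \<theta>) / ?x + d - (d - \<beta>) / (?x * r)"
      proof -
        have "(y + x * d - z / r) / x = y / x + d - z / (x * r)" if "0 < x" for x y z
          using that by (simp add: add_divide_distrib diff_divide_distrib mult.commute)
        then show ?thesis using x by blast
      qed
      also have "?x * r = \<beta> * L" using split rb pos by (simp add: field_simps)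
      also have "B * r powr (1 - \<theta>) / ?x = a * q * L powr (q - 1)"
      proof -
        \<comment> \<open>Since r^\<beta> = L / b, a power of \<open>r\<close> with exponent \<beta>
          (q - 1) is the power q - 1 of L / b.\<close>
        have "r powr (1 - \<theta>) / r powr (\<beta> - 1) = r powr (\<beta> * (q - 1))"
        proof -
          have "\<beta> * (q - 1) = 1 - \<theta> - (\<beta> - 1)" using pos by (simp add: q field_simps)
          then show ?thesis by (simp only: powr_diff[symmetric])
        qed
        also have "\<dots> = L powr (q - 1) * b powr (1 - q)"
          using pos elim(2) by (simp add: powr_powr[symmetric] rb powr_divide powr_diff field_simps)
        also have "b powr (1 - q) = b powr (- q) * b"
          using pos powr_add[of b "- q" 1] by simp
        finally have "r powr (1 - \<theta>) = L powr (q - 1) * b powr (- q) * b * r powr (\<beta> - 1)"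
          using r by (simp add: field_simps)
        moreover have "a * q = B * b powr (- q) / \<beta>"
          using pos by (simp add: a q)
        ultimately show ?thesis using pos r by (simp add: field_simps)
      qed
      finally show ?thesis by simp
    qed
    ultimately show ?case by simp
  qed
qed

text \<open>The difference of f(exp x) and g(x) is nondecreasing. A linear \<open>g\<close> will
  give growth between radii, and the antiderivative of the full slope bound will control the
  weight.\<close>

lemma profile_increment_ge:
  fixes f g :: "real \<Rightarrow> real"
  assumes "C2_profile f"
    and g: "\<And>x. L\<^sub>0 \<le> x \<Longrightarrow> (g has_real_derivative g' x) (at x)"
    and le: "\<And>x. L\<^sub>0 \<le> x \<Longrightarrow> g' x \<le> deriv f (exp x) * exp x"
    and "L\<^sub>0 \<le> L" "L \<le> M"
  shows "g M - g L \<le> f (exp M) - f (exp L)"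
proof -
  have "f (exp L) - g L \<le> f (exp M) - g M"
  proof (rule DERIV_nonneg_imp_nondecreasing[OF \<open>L \<le> M\<close>])
    fix x assume "L \<le> x"
    then have x: "L\<^sub>0 \<le> x" using assms(4) by simp
    have "((\<lambda>x. f (exp x) - g x) has_real_derivative deriv f (exp x) * exp x - g' x) (at x)"
      by (intro DERIV_diff DERIV_chain2[OF C2_profile_DERIV(1)[OF assms(1)] DERIV_exp] g x)
    then show "\<exists>y. ((\<lambda>x. f (exp x) - g x) has_real_derivative y) (at x) \<and> 0 \<le> y"
      using le[OF x] by (intro exI conjI) auto
  qed
  then show ?thesis by simp
qed

subsection \<open>Logarithmic weights\<close>

text \<open>For \<open>q > 1\<close> the logarithmic slope of the profile is unbounded, so any
  growth rate \<open>G\<close> is available and \<kappa> = 1 works. For \<open>q = 1\<close> the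
  lower bound tends to d + a > d + \<alpha>, which gives only \<open>G = d + \<alpha>\<close>, and a
  small \<kappa> makes up for it. Integrating the slope exactly yields the bound on the
  weight.\<close>

lemma super_poincare_log_profile:
  fixes F :: "'a::euclidean_space \<Rightarrow> real" and f :: "real \<Rightarrow> real" and a q k \<alpha> \<delta> :: real
  defines "w \<equiv> \<lambda>R. 1 / 2 powr (real DIM('a) + \<alpha>) * R powr (a * ln R powr (q - 1) + \<delta>) * ln R powr (- k)"
  assumes isotropic: "\<And>x. F x = f (norm x)" and C2: "C2_profile f"
    and prob: "prob_space (gibbs F)" and \<alpha>: "0 < \<alpha>" and \<delta>: "\<delta> \<le> - \<alpha>" and a: "0 < a"
    and cases: "1 < q \<or> q = 1 \<and> \<alpha> < a"
    and slope: "\<forall>\<^sub>F L in at_top. real DIM('a) - k / L + a * q * L powr (q - 1) \<le> deriv f (exp L) * exp L"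
  shows "\<exists>C>0. \<exists>\<omega>. \<omega> \<in> borel_measurable borel \<and> (\<forall>x. 0 < \<omega> x) \<and> integrable (gibbs F) \<omega> \<and>
    (\<forall>\<^sub>F x in at_infinity. \<omega> x = C * w (norm x)) \<and> super_poincare F \<alpha> (super_rate F \<alpha> \<omega>)"
proof -
  let ?d = "real DIM('a)"
  define K where "K = 4 / unit_ball_vol ?d + 1"
  let ?g' = "\<lambda>L. ?d - k / L + a * q * L powr (q - 1)"
  have K: "1 \<le> K" by (simp add: K_def)
  have d: "1 \<le> ?d" by (simp add: Suc_leI)
  have kL: "k / L \<le> \<bar>k\<bar> / L" if "0 < L" for L
    using that by (intro divide_right_mono) auto
  obtain G \<kappa> C\<^sub>0 where G: "?d + \<alpha> \<le> G" "\<forall>\<^sub>F L in at_top. G \<le> ?g' L"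
    and \<kappa>: "0 < \<kappa>" "\<kappa> \<le> 1" "ln K \<le> G * ln (4 / (3 * \<kappa>))"
    and C0: "0 < C\<^sub>0" "\<forall>\<^sub>F R in at_top. w (R / \<kappa>) \<le> C\<^sub>0 * w R"
    using cases
  proof (elim disjE conjE)
    assume q: "1 < q"
    \<comment> \<open>The second entry gives K \<le> (4/3)^G, the growth of \<open>exp f\<close>
      required between the radii \<open>3 / 2 * t\<close> and \<open>2 * t\<close>.\<close>
    define G where "G = max (?d + \<alpha>) (ln K / ln (4 / 3))"
    have "\<forall>\<^sub>F L in at_top. (G - ?d + \<bar>k\<bar>) / (a * q) \<le> L powr (q - 1)"
      using filterlim_powr_at_top[of "q - 1"] q by (simp add: filterlim_at_top)
    then have "\<forall>\<^sub>F L in at_top. G \<le> ?g' L"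
      using eventually_ge_at_top[of 1]
    proof eventually_elim
      case (elim L)
      have "\<bar>k\<bar> / L \<le> \<bar>k\<bar> / 1" using elim by (intro divide_left_mono) auto
      then have "k / L \<le> \<bar>k\<bar>" using kL[of L] elim by simp
      moreover have "G - ?d + \<bar>k\<bar> \<le> a * q * L powr (q - 1)"
        using elim(1) a q by (simp only: pos_divide_le_eq mult_pos_pos mult.commute less_trans[OF zero_less_one])
      ultimately show ?case by simp
    qed
    moreover have "ln K \<le> G * ln (4 / (3 * 1))"
    proof -
      have "ln K / ln (4 / 3) \<le> G" by (simp add: G_def)
      then show ?thesis by (simp add: pos_divide_le_eq)
    qed
    ultimately show thesis
      by (intro that[of G 1 1]) (simp_all add: G_def)
  next
    assume q: "q = 1" and a\<alpha>: "\<alpha> < a"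
    \<comment> \<open>Here \<open>f(2t) - f(\<kappa>t)\<close> may stay bounded for fixed \<open>\<kappa>\<close>, so \<open>\<kappa>\<close> has to be small.\<close>
    define \<kappa> where "\<kappa> = 1 / K"
    have \<kappa>: "0 < \<kappa>" "\<kappa> \<le> 1" using K by (simp_all add: \<kappa>_def)
    have "\<forall>\<^sub>F L in at_top. ?d + \<alpha> \<le> ?g' L"
      using eventually_ge_at_top[of "\<bar>k\<bar> / (a - \<alpha>)"] eventually_gt_at_top[of 0]
    proof eventually_elim
      case (elim L)
      have "\<bar>k\<bar> \<le> L * (a - \<alpha>)" using elim a\<alpha> by (simp add: pos_divide_le_eq)
      then have "\<bar>k\<bar> / L \<le> a - \<alpha>" using elim by (simp add: pos_divide_le_eq mult.commute)
      then show ?case using kL[OF elim(2)] elim by (simp add: q)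
    qed
    moreover have "ln K \<le> (?d + \<alpha>) * ln (4 / (3 * \<kappa>))"
    proof -
      have "ln K \<le> 1 * ln (4 / 3 * K)" using K by simp
      also have "\<dots> \<le> (?d + \<alpha>) * ln (4 / 3 * K)"
      proof (rule mult_right_mono)
        show "0 \<le> ln (4 / 3 * K)" using K by (intro ln_ge_zero) linarith
      qed (use d \<alpha> in linarith)
      also have "4 / 3 * K = 4 / (3 * \<kappa>)" by (simp add: \<kappa>_def)
      finally show ?thesis .
    qed
    moreover have "\<forall>\<^sub>F R in at_top. w (R / \<kappa>) \<le> \<kappa> powr (- (a + \<delta>)) * 2 powr \<bar>k\<bar> * w R"
      using eventually_ge_at_top[of "exp 1"] eventually_ge_at_top[of "1 / \<kappa>"]
    proof eventually_elim
      case (elim R)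
      have R: "0 < R" using elim(1) exp_gt_zero[of 1] by linarith
      have L: "1 \<le> ln R" using elim(1) R by (simp add: ln_ge_iff)
      have lk: "ln (R / \<kappa>) = ln R + ln (1 / \<kappa>)"
        using R \<kappa> by (simp add: ln_div)
      have "0 \<le> ln (1 / \<kappa>)" using \<kappa> by simp
      then have L1: "ln R \<le> ln (R / \<kappa>)" using lk by simp
      have "ln (1 / \<kappa>) \<le> ln R" using elim(2) \<kappa> R by (subst ln_le_cancel_iff) auto
      then have L2: "ln (R / \<kappa>) \<le> 2 * ln R" using lk by simp
      \<comment> \<open>For \<open>k \<ge> 0\<close> a larger logarithm only lowers the power; for
        negative \<open>k\<close> the logarithm has at most doubled, since
        \<open>R \<ge> 1 / \<kappa>\<close>.\<close>
      have *: "ln (R / \<kappa>) powr (- k) \<le> 2 powr \<bar>k\<bar> * ln R powr (- k)"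
      proof (cases "0 \<le> k")
        case True
        have "ln (R / \<kappa>) powr (- k) \<le> 1 * ln R powr (- k)"
          using L L1 True by (simp add: powr_mono2')
        also have "\<dots> \<le> 2 powr \<bar>k\<bar> * ln R powr (- k)"
          by (intro mult_right_mono ge_one_powr_ge_zero) auto
        finally show ?thesis .
      next
        case False
        have "ln (R / \<kappa>) powr (- k) \<le> (2 * ln R) powr (- k)"
          using L L1 L2 False by (intro powr_mono2) auto
        then show ?thesis using False L by (simp add: powr_mult)
      qed
      \<comment> \<open>With \<open>q = 1\<close> the logarithm in the exponent has power 0, which
        equals 1 only for a nonzero base, as \<open>0 powr 0 = 0\<close>.\<close>
      have one: "ln R powr 0 = 1" "ln (R / \<kappa>) powr 0 = 1" using L L1 by auto
      have "w (R / \<kappa>) = 1 / 2 powr (?d + \<alpha>) * (R / \<kappa>) powr (a + \<delta>) * ln (R / \<kappa>) powr (- k)"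
        unfolding w_def q using one by simp
      also have "\<dots> \<le> 1 / 2 powr (?d + \<alpha>) * (R / \<kappa>) powr (a + \<delta>) * (2 powr \<bar>k\<bar> * ln R powr (- k))"
        using * by (intro mult_left_mono) auto
      also have "(R / \<kappa>) powr (a + \<delta>) = R powr (a + \<delta>) * \<kappa> powr (- (a + \<delta>))"
        using powr_divide[of R \<kappa> "a + \<delta>"] R \<kappa> by (simp only: powr_minus divide_inverse less_imp_le)
      also have "1 / 2 powr (?d + \<alpha>) * (R powr (a + \<delta>) * \<kappa> powr (- (a + \<delta>))) * (2 powr \<bar>k\<bar> * ln R powr (- k))
        = \<kappa> powr (- (a + \<delta>)) * 2 powr \<bar>k\<bar> * w R"
        unfolding w_def q using one by simp
      finally show ?case .
    qed
    ultimately show thesis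
      using \<kappa> by (intro that[of "?d + \<alpha>" \<kappa> "\<kappa> powr (- (a + \<delta>)) * 2 powr \<bar>k\<bar>"]) simp_all
  qed
  obtain L\<^sub>0 where L0: "1 \<le> L\<^sub>0" "\<And>L. L\<^sub>0 \<le> L \<Longrightarrow> ?g' L \<le> deriv f (exp L) * exp L" "\<And>L. L\<^sub>0 \<le> L \<Longrightarrow> G \<le> ?g' L"
  proof -
    have "\<forall>\<^sub>F L in at_top. ?g' L \<le> deriv f (exp L) * exp L \<and> G \<le> ?g' L"
      using slope G(2) by (rule eventually_conj)
    then obtain l where "\<forall>L\<ge>l. ?g' L \<le> deriv f (exp L) * exp L \<and> G \<le> ?g' L"
      unfolding eventually_at_top_linorder by blast
    then show thesis by (intro that[of "max 1 l"]) auto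
  qed
  obtain R1 where R1: "\<And>R. R1 \<le> R \<Longrightarrow> w (R / \<kappa>) \<le> C\<^sub>0 * w R"
    using C0(2) unfolding eventually_at_top_linorder by blast
  let ?R = "max (exp L\<^sub>0) R1"
  have lnR: "L\<^sub>0 \<le> ln R" "exp (ln R) = R" "0 < R" if "?R \<le> R" for R
  proof -
    show R: "0 < R" using that exp_gt_zero[of L\<^sub>0] by linarith
    then show "exp (ln R) = R" by simp
    show "L\<^sub>0 \<le> ln R" using that R by (subst ln_ge_iff) auto
  qed
  have incr: "G * ln (S / R) \<le> f S - f R" if "?R \<le> R" "R \<le> S" for R S
  proof -
    have S: "?R \<le> S" using that by linarith
    have "G * ln S - G * ln R \<le> f (exp (ln S)) - f (exp (ln R))"
    proof (rule profile_increment_ge[OF C2, where g' = "\<lambda>_. G" and L\<^sub>0 = L\<^sub>0])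
      show "((*) G has_real_derivative G) (at x)" for x
        by (auto intro!: derivative_eq_intros)
      show "G \<le> deriv f (exp x) * exp x" if "L\<^sub>0 \<le> x" for x
        using L0(2,3)[OF that] by linarith
      show "ln R \<le> ln S" using that lnR(3)[OF that(1)] by simp
    qed (rule lnR(1)[OF that(1)])
    then show ?thesis
      using lnR[OF that(1)] lnR[OF S] by (simp add: ln_div right_diff_distrib)
  qed
  have incr_pos: "0 \<le> ln (S / R)" if "?R \<le> R" "R \<le> S" for R S
    using that lnR(3)[OF that(1)] by (intro ln_ge_zero) simp
  \<comment> \<open>An antiderivative of \<open>?g'\<close>. For \<delta> = -\<alpha>,
    \<open>exp (g L)\<close> is exactly \<open>(2 * R) powr (d + \<alpha>) * w R\<close> at
    \<open>R = exp L\<close>, so comparing increments of \<open>g\<close> and of the profile bounds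
    the product.\<close>
  define g where "g L = ?d * L - k * ln L + a * L powr q" for L
  have weight: "(2 * R) powr (?d + \<alpha>) * exp (- f R) * w R \<le> exp (g L\<^sub>0 - f (exp L\<^sub>0))" if "?R \<le> R" for R
  proof -
    note R = lnR[OF that]
    define L where "L = ln R"
    have L: "L\<^sub>0 \<le> L" "0 < L" "R = exp L"
      unfolding L_def using R L0(1) by linarith+
    have inc: "g L - g L\<^sub>0 \<le> f (exp L) - f (exp L\<^sub>0)"
    proof (rule profile_increment_ge[OF C2, where g' = ?g' and L\<^sub>0 = L\<^sub>0])
      show "(g has_real_derivative ?g' x) (at x)" if "L\<^sub>0 \<le> x" for x
        unfolding g_def using that L0(1) by (auto intro!: derivative_eq_intros)
    qed (use L0 L in auto)
    have "(2 * R) powr (?d + \<alpha>) * exp (- f R) * w R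
      = exp ((?d + \<alpha>) * L) * exp (- f R) * exp ((a * L powr (q - 1) + \<delta>) * L) * exp (- k * ln L)"
    proof -
      have "R powr s = exp (s * L)" "L powr s = exp (s * ln L)" for s
        using L by (simp_all add: powr_def)
      moreover have "(2 * R) powr s * (1 / 2 powr s) = R powr s" for s
        using R by (simp add: powr_mult)
      moreover have "u * e * (v * x * y) = u * v * e * x * y" for u v e x y :: real
        by (simp only: ac_simps)
      ultimately show ?thesis
        unfolding w_def L_def[symmetric] by (simp only:)
    qed
    also have "\<dots> = exp ((?d + \<alpha>) * L - f R + (a * L powr (q - 1) + \<delta>) * L - k * ln L)"
      by (simp add: exp_add[symmetric])
    finally have eq: "(2 * R) powr (?d + \<alpha>) * exp (- f R) * w R
      = exp ((?d + \<alpha>) * L - f R + (a * L powr (q - 1) + \<delta>) * L - k * ln L)" .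
    \<comment> \<open>The assumption \<delta> \<le> -\<alpha> cancels the surplus \<alpha> L,
      leaving the term d L of \<open>g\<close>.\<close>
    have le: "(?d + \<alpha>) * L - f R + (a * L powr (q - 1) + \<delta>) * L - k * ln L \<le> g L - f R"
    proof -
      have "L powr (q - 1) * L = L powr q"
        using L powr_add[of L "q - 1" 1] by simp
      then have split: "(a * L powr (q - 1) + \<delta>) * L = a * L powr q + \<delta> * L"
        by (simp add: distrib_right mult.assoc)
      have "\<delta> * L \<le> - \<alpha> * L" using \<delta> L by (intro mult_right_mono) auto
      then show ?thesis unfolding split g_def by (simp add: distrib_right)
    qed
    show ?thesis
      unfolding eq exp_le_cancel_iff using le inc unfolding L(3)[symmetric] by linarith
  qed
  show ?thesis
  proof (rule super_poincare_radial[OF isotropic _ prob \<alpha>, where R\<^sub>0 = ?R and \<kappa> = \<kappa> and C\<^sub>0 = C\<^sub>0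
        and c\<^sub>1 = "exp (g L\<^sub>0 - f (exp L\<^sub>0))"])
    show "continuous_on UNIV f"
      using C2 by (simp add: C2_profile_def differentiable_imp_continuous_on)
    show "w \<in> borel_measurable borel" unfolding w_def by measurable
    show "1 \<le> ?R" using L0(1) by (simp add: le_max_iff_disj)
    show "0 < w R" if "?R \<le> R" for R
      using lnR[OF that] L0(1) unfolding w_def by (intro mult_pos_pos divide_pos_pos) auto
    show "(?d + \<alpha>) * ln (S / R) \<le> f S - f R" if "?R \<le> R" "R \<le> S" for R S
      using incr[OF that] mult_right_mono[OF G(1) incr_pos[OF that]] by linarith
    show "w (R / \<kappa>) \<le> C\<^sub>0 * w R" if "?R \<le> R" for R
      using R1 that by simp
    show "(4 / unit_ball_vol ?d + 1) * exp (f R) \<le> exp (f (2 * t))" if "?R \<le> R" "R \<le> 3 / 2 * (\<kappa> * t)" for R t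
    proof -
      have R: "0 < R" by (rule lnR(3)[OF that(1)])
      have "0 < \<kappa> * t" using R that(2) by linarith
      then have t: "0 < t" using \<kappa>(1) by (simp add: zero_less_mult_iff)
      \<comment> \<open>The worst radius is \<open>R = 3 / 2 * (\<kappa> * t)\<close>; from there to
        \<open>2 * t\<close> the growth at rate \<open>G\<close> yields the factor \<open>K\<close>
        by the choice of \<kappa> and \<open>G\<close>.\<close>
      have ratio: "4 / (3 * \<kappa>) \<le> 2 * t / R"
        using that(2) R \<kappa>(1) by (simp add: field_simps)
      have "\<kappa> * t \<le> 1 * t" using \<kappa> t by (intro mult_right_mono) auto
      then have "R \<le> 2 * t" using that(2) t by linarith
      have "ln K \<le> G * ln (4 / (3 * \<kappa>))" by (rule \<kappa>)
      also have "\<dots> \<le> G * ln (2 * t / R)"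
        using ratio \<kappa> G(1) \<alpha> R t by (intro mult_left_mono) (subst ln_le_cancel_iff, auto)
      also have "\<dots> \<le> f (2 * t) - f R"
        using incr[OF that(1) \<open>R \<le> 2 * t\<close>] .
      finally have "exp (ln K + f R) \<le> exp (f (2 * t))" by simp
      moreover have "exp (ln K) = K" using K by (intro exp_ln) linarith
      ultimately show ?thesis by (simp only: exp_add K_def)
    qed
  qed (use \<kappa> C0 weight in auto)
qed

section \<open>The two regimes separated by the critical exponent 2 - \<beta>\<close>

theorem proposition3:
  fixes F :: "'a::euclidean_space \<Rightarrow> real" and f :: "real \<Rightarrow> real"
    and \<beta> b \<mu> N\<^sub>2 \<theta> \<alpha> d :: real
  assumes d: "d = real DIM('a)"
    and beta: "1 < \<beta>" "\<beta> \<le> 2" and b: "0 < b"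
    and isotropic: "\<And>x. F x = f (norm x)"
    and C2: "C2_profile f"
    and density: "prob_space (gibbs F)"
    and pos: "0 < \<mu>" "0 < N\<^sub>2" "0 \<le> \<theta>"
    and convex1: "\<And>x::'a. N\<^sub>2 < norm x \<Longrightarrow> b powr (- 1 / \<beta>) \<le> norm x \<Longrightarrow>
      deriv f (psi b \<beta> (norm x)) * deriv (psi b \<beta>) (norm x) * norm x powr (- 1)
        - b * \<beta> * d * norm x powr (\<beta> - 2) + (d - \<beta>) * norm x powr (- 2)
      > \<mu> / (1 + 1 / 4 * (norm x)\<^sup>2) powr (\<theta> / 2)"
    and convex2: "\<And>x::'a. N\<^sub>2 < norm x \<Longrightarrow> b powr (- 1 / \<beta>) \<le> norm x \<Longrightarrow>
      deriv (deriv f) (psi b \<beta> (norm x)) * (deriv (psi b \<beta>) (norm x))\<^sup>2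
        + deriv f (psi b \<beta> (norm x)) * deriv (deriv (psi b \<beta>)) (norm x)
        - b * \<beta> * (\<beta> - 1) * d * norm x powr (\<beta> - 2) - (d - \<beta>) * norm x powr (- 2)
      > \<mu> / (1 + 1 / 4 * (norm x)\<^sup>2) powr (\<theta> / 2)"
    and alpha: "0 < \<alpha>" "\<alpha> < 2"
  shows
    "(\<theta> < 2 - \<beta> \<or> \<theta> = 2 - \<beta> \<and> \<alpha> < \<mu> / (\<beta> * b) \<longrightarrow>
       (\<exists>C>0. \<exists>\<omega> :: 'a \<Rightarrow> real.
          \<omega> \<in> borel_measurable borel \<and> (\<forall>x. 0 < \<omega> x) \<and> integrable (gibbs F) \<omega> \<and>
          (\<forall>\<^sub>F x in at_infinity. \<omega> x =
             (if \<theta> < 2 - \<beta>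
              then C / 2 powr (d + \<alpha>)
                * norm x powr
                    (1 / (1 - \<theta>) * (1 / (2 - \<theta>)) * \<mu> * b powr (- (2 - \<theta>) / \<beta>)
                      * ln (norm x) powr ((2 - \<theta>) / \<beta> - 1) + 1 - (d + \<alpha>))
                * ln (norm x) powr (- (d - \<beta>) / \<beta>)
              else C / 2 powr (d + \<alpha>)
                * norm x powr
                    (1 / (2 - \<theta>) * \<mu> * b powr (- (2 - \<theta>) / \<beta>)
                      * ln (norm x) powr ((2 - \<theta>) / \<beta> - 1) - \<alpha>)
                * ln (norm x) powr (- (d - \<beta>) / \<beta>))) \<and>
          super_poincare F \<alpha> (super_rate F \<alpha> \<omega>))) \<and>
     (\<theta> = 2 - \<beta> \<and> \<mu> / (\<beta> * b) \<le> \<alpha> \<or> 2 - \<beta> < \<theta> \<longrightarrow>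
       weak_poincare F \<alpha> (weak_rate F \<alpha>))"
proof (intro conjI impI)
  have cont: "continuous_on UNIV f"
    using C2 by (simp add: C2_profile_def differentiable_imp_continuous_on)
  have "F \<in> borel_measurable borel"
    using isotropic cont by (rule borel_measurable_radial)
  then show "weak_poincare F \<alpha> (weak_rate F \<alpha>)"
    by (rule weak_poincare_weak_rate[OF _ density])
next
  assume \<theta>: "\<theta> < 2 - \<beta> \<or> \<theta> = 2 - \<beta> \<and> \<alpha> < \<mu> / (\<beta> * b)"
  \<comment> \<open>Here \<theta> \<le> 2 - \<beta> < 1, because \<beta> > 1.\<close>
  then have \<theta>1: "\<theta> < 1" using beta by auto
  define N where "N = max N\<^sub>2 (b powr (- 1 / \<beta>))"
  define q where "q = (2 - \<theta>) / \<beta>"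
  \<comment> \<open>The subcritical weight carries the constant from integrating the second
    convexity inequality, the critical one the constant from the first.\<close>
  define B where "B = (if \<theta> < 2 - \<beta> then \<mu> / (1 - \<theta>) else \<mu>)"
  define a where "a = B / (2 - \<theta>) * b powr (- q)"
  define \<delta> where "\<delta> = (if \<theta> < 2 - \<beta> then 1 - (d + \<alpha>) else - \<alpha>)"
  have B: "0 < B" "B = \<mu> \<or> B = \<mu> / (1 - \<theta>)" using pos \<theta>1 by (auto simp: B_def)
  have slope: "\<forall>\<^sub>F r in at_top. B * r powr (1 - \<theta>)
      \<le> deriv f (psi b \<beta> r) * deriv (psi b \<beta>) r - b * \<beta> * d * r powr (\<beta> - 1) + (d - \<beta>) / r"
  proof (rule slope_lower_bound[OF C2 pos(1) pos(3) \<theta>1 b _ _ B(2), where N = N])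
    fix r :: real assume r: "N < r" "0 < r"
    \<comment> \<open>The assumptions are stated for vectors; a vector of each norm exists, so they
      hold for every radius beyond \<open>N\<close>.\<close>
    obtain x :: 'a where x: "norm x = r" using vector_choose_size[of r] r by auto
    have *: "N\<^sub>2 < norm x" "b powr (- 1 / \<beta>) \<le> norm x" using r by (simp_all add: x N_def)
    show "\<mu> / (1 + 1 / 4 * r\<^sup>2) powr (\<theta> / 2) < deriv f (psi b \<beta> r) * deriv (psi b \<beta>) r * r powr (- 1)
        - b * \<beta> * d * r powr (\<beta> - 2) + (d - \<beta>) * r powr (- 2)"
      using convex1[OF *] unfolding x .
    show "\<mu> / (1 + 1 / 4 * r\<^sup>2) powr (\<theta> / 2) < deriv (deriv f) (psi b \<beta> r) * (deriv (psi b \<beta>) r)\<^sup>2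
        + deriv f (psi b \<beta> r) * deriv (deriv (psi b \<beta>)) r
        - b * \<beta> * (\<beta> - 1) * d * r powr (\<beta> - 2) - (d - \<beta>) * r powr (- 2)"
      using convex2[OF *] unfolding x .
  qed
  have log_slope: "\<forall>\<^sub>F L in at_top. d - (d - \<beta>) / \<beta> / L + a * q * L powr (q - 1) \<le> deriv f (exp L) * exp L"
    by (rule log_slope_lower_bound[OF _ b _ slope q_def a_def]) (use \<theta>1 beta in auto)
  have "\<exists>C>0. \<exists>\<omega>. \<omega> \<in> borel_measurable borel \<and> (\<forall>x. 0 < \<omega> x) \<and> integrable (gibbs F) \<omega> \<and>
    (\<forall>\<^sub>F x in at_infinity. \<omega> x = C * (1 / 2 powr (real DIM('a) + \<alpha>)
       * norm x powr (a * ln (norm x) powr (q - 1) + \<delta>) * ln (norm x) powr (- ((d - \<beta>) / \<beta>))))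
    \<and> super_poincare F \<alpha> (super_rate F \<alpha> \<omega>)"
  proof (rule super_poincare_log_profile[OF isotropic C2 density alpha(1)])
    have "1 \<le> d" by (simp add: d Suc_leI)
    then show "\<delta> \<le> - \<alpha>" by (simp add: \<delta>_def)
    show "0 < a" using B(1) \<theta>1 b by (simp add: a_def)
    \<comment> \<open>Subcritical means 2 - \<theta> > \<beta>, that is \<open>q > 1\<close>. In the
      critical case \<open>q = 1\<close> and \<open>a = \<mu> / (\<beta> * b)\<close>, so the
      assumption on \<alpha> is exactly \<alpha> < a.\<close>
    show "1 < q \<or> q = 1 \<and> \<alpha> < a"
    proof (cases "\<theta> < 2 - \<beta>")
      case True
      then show ?thesis using beta by (simp add: q_def)
    next
      case False
      with \<theta> have "2 - \<theta> = \<beta>" "\<alpha> < \<mu> / (\<beta> * b)" by auto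
      moreover from this have "q = 1" using beta by (simp add: q_def)
      ultimately show ?thesis using False b by (simp add: a_def B_def powr_minus_divide)
    qed
  qed (use log_slope d in simp)
  then obtain C \<omega> where "0 < C" and \<omega>: "\<omega> \<in> borel_measurable borel" "\<forall>x. 0 < \<omega> x" "integrable (gibbs F) \<omega>"
    "super_poincare F \<alpha> (super_rate F \<alpha> \<omega>)"
    and ev: "\<forall>\<^sub>F x in at_infinity. \<omega> x = C * (1 / 2 powr (d + \<alpha>)
       * norm x powr (a * ln (norm x) powr (q - 1) + \<delta>) * ln (norm x) powr (- ((d - \<beta>) / \<beta>)))"
    unfolding d by blast
  have "\<forall>\<^sub>F x in at_infinity. \<omega> x =
             (if \<theta> < 2 - \<beta>
              then C / 2 powr (d + \<alpha>)
                * norm x powr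
                    (1 / (1 - \<theta>) * (1 / (2 - \<theta>)) * \<mu> * b powr (- (2 - \<theta>) / \<beta>)
                      * ln (norm x) powr ((2 - \<theta>) / \<beta> - 1) + 1 - (d + \<alpha>))
                * ln (norm x) powr (- (d - \<beta>) / \<beta>)
              else C / 2 powr (d + \<alpha>)
                * norm x powr
                    (1 / (2 - \<theta>) * \<mu> * b powr (- (2 - \<theta>) / \<beta>)
                      * ln (norm x) powr ((2 - \<theta>) / \<beta> - 1) - \<alpha>)
                * ln (norm x) powr (- (d - \<beta>) / \<beta>))"
    using ev
  proof eventually_elim
    case (elim x)
    have exponent: "b powr (- (2 - \<theta>) / \<beta>) = b powr (- q)" by (simp only: q_def minus_divide_left)
    have 1: "a * l + \<delta> = 1 / (1 - \<theta>) * (1 / (2 - \<theta>)) * \<mu> * b powr (- (2 - \<theta>) / \<beta>) * l + 1 - (d + \<alpha>)"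
      if "\<theta> < 2 - \<beta>" for l
      unfolding exponent using that by (simp add: a_def B_def \<delta>_def)
    have 2: "a * l + \<delta> = 1 / (2 - \<theta>) * \<mu> * b powr (- (2 - \<theta>) / \<beta>) * l - \<alpha>" if "\<not> \<theta> < 2 - \<beta>" for l
      unfolding exponent using that by (simp add: a_def B_def \<delta>_def)
    have 3: "C / 2 powr (d + \<alpha>) * u * v = C * (1 / 2 powr (d + \<alpha>) * u * v)" for u v by simp
    have 4: "- (d - \<beta>) / \<beta> = - ((d - \<beta>) / \<beta>)" by (rule minus_divide_left[symmetric])
    show ?case
      unfolding 3 4 q_def[symmetric] using elim 1 2 by (simp only: split: if_split) auto
  qed
  then show "\<exists>C>0. \<exists>\<omega> :: 'a \<Rightarrow> real.
          \<omega> \<in> borel_measurable borel \<and> (\<forall>x. 0 < \<omega> x) \<and> integrable (gibbs F) \<omega> \<and>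
          (\<forall>\<^sub>F x in at_infinity. \<omega> x =
             (if \<theta> < 2 - \<beta>
              then C / 2 powr (d + \<alpha>)
                * norm x powr
                    (1 / (1 - \<theta>) * (1 / (2 - \<theta>)) * \<mu> * b powr (- (2 - \<theta>) / \<beta>)
                      * ln (norm x) powr ((2 - \<theta>) / \<beta> - 1) + 1 - (d + \<alpha>))
                * ln (norm x) powr (- (d - \<beta>) / \<beta>)
              else C / 2 powr (d + \<alpha>)
                * norm x powr
                    (1 / (2 - \<theta>) * \<mu> * b powr (- (2 - \<theta>) / \<beta>)
                      * ln (norm x) powr ((2 - \<theta>) / \<beta> - 1) - \<alpha>)
                * ln (norm x) powr (- (d - \<beta>) / \<beta>))) \<and>
          super_poincare F \<alpha> (super_rate F \<alpha> \<omega>)"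
    using \<open>0 < C\<close> \<omega> by blast
qed

end
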